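(* Let $(X,d)$ be a compact metric space equipped with a computable structure $\mathcal{I}$, and let $T:X\to X$ be uniformly constructive with respect to $\mathcal{I}$ (i.e. as a map $(X,d,\mathcal{I})\to(X,d,\mathcal{I})$). Then for every monotonic function $f:\mathbb{N}\to\mathbb{R}$ with $\lim_{n\to\infty}f(n)=\infty$ and every $x\in X$, $$\hat{K}^f(x,T)\le h^f(T).$$
   Context: Algorithmic information content. Let $\Sigma=\{0,1\}^*$ be the set of finite (possibly empty) binary strings and $|p|$ the length of $p\in\Sigma$. Fix a universal computing machine (universal partial recursive function) $\mathcal{U}$ taking binary strings as programs and giving as output strings over a finite alphabet, and a recursive injective encoding $(s',p)\mapsto\langle s',p\rangle$ of pairs of strings into strings, from which $\mathcal{U}$ can recover both components; universal means that it can emulate any other computing machine when given an appropriate fixed additional input. The conditional algorithmic information content is $AIC(s|s')=\min\{|p| : \mathcal{U}(\langle s',p\rangle)=s\}$. A natural number $n$ used as a condition is represented by its binary expansion. Orbit complexity. For a finite open cover $\beta=\{B_0,\dots,B_{N-1}\}$ of $X$ and $x\in X$ let $$\varphi_\beta(x)=\{\omega\in\{0,\dots,N-1\}^{\mathbb{N}} : \forall n\in\mathbb{N},\ T^n(x)\in B_{\omega(n)}\}.$$ Let $\omega^n$ denote the string of the first $n$ digits of $\omega$, and put $\hat{K}(x,T,\beta,n)=\min_{\omega\in\varphi_\beta(x)}AIC(\omega^n|n)$, $\hat{K}^f(x,T,\beta)=\limsup_{n\to\infty}\hat{K}(x,T,\beta,n)/f(n)$ and $\hat{K}^f(x,T)=\sup_\beta\hat{K}^f(x,T,\beta)$,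 the supremum being over all finite open covers $\beta$ of $X$. Generalized topological entropy. Points $x,y\in X$ are $(n,\epsilon)$-separated if $d(T^k(x),T^k(y))>\epsilon$ for some $k\in\{0,\dots,n-1\}$. A set $E\subset X$ is $(n,\epsilon)$-separated if any two distinct points of $E$ are $(n,\epsilon)$-separated. Let $s(n,\epsilon)$ be the maximal cardinality of an $(n,\epsilon)$-separated set, $h^f(T,\epsilon)=\limsup_{n\to\infty}\frac{\log s(n,\epsilon)}{f(n)}$ and $h^f(T)=\lim_{\epsilon\to0}h^f(T,\epsilon)$ (the limit exists by monotonicity in $\epsilon$). Here $\log$ is the logarithm in base $2$. Computable structures. A computable interpretation on $(X,d)$ is a function $I:\Sigma\to X$ with dense image for which there is a total recursive function $D:\Sigma\times\Sigma\times\mathbb{N}\to\mathbb{Q}$ with $|d(I(s_1),I(s_2))-D(s_1,s_2,n)|\le2^{-n}$ for all $s_1,s_2\in\Sigma$, $n\in\mathbb{N}$. Two computable interpretations $I_1,I_2$ are equivalent if there is a total recursive $D^*:\Sigma\times\Sigma\times\mathbb{N}\to\mathbb{Q}$ with $|d(I_1(s_1),I_2(s_2))-D^*(s_1,s_2,n)|\le2^{-n}$ for all $s_1,s_2,n$; this is an equivalence relation. A computable structure on $X$ is an equivalence class of computable interpretations. Constructive maps. If $(X,d,\mathcal{I})$ and $(Y,d',\mathcal{J})$ are metric spaces with computable structures, $\Psi:X\to Y$ is a morphism if it is continuous and for each $I\in\mathcal{I}$, $J\in\mathcal{J}$ there is a total recursive $D^*:\Sigma\times\Sigma\times\mathbb{N}\to\mathbb{Q}$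 with $|d'(\Psi(I(s_1)),J(s_2))-D^*(s_1,s_2,n)|\le2^{-n}$ for all $s_1,s_2\in\Sigma$, $n\in\mathbb{N}$. $\Psi$ is uniformly constructive if it is a morphism and there is a total recursive function $g:\mathbb{N}\to\mathbb{N}$ such that for all $n\in\mathbb{N}$ and $x,y\in X$, $d(x,y)<2^{-g(n)}$ implies $d'(\Psi(x),\Psi(y))<2^{-n}$. *)

theory Defs
  imports "HOL-Analysis.Analysis" "HOL-Library.Nat_Bijection"
begin

section \<open>Partial recursive functions\<close>

text \<open>
  Kleene's \<open>\<mu>\<close>-recursive functions on the natural numbers.  The syntax carries no arities:
  a description computes, for every \<open>k\<close>, a partial function of \<open>k\<close> arguments, given by its values
  on the argument lists of length \<open>k\<close>.  \<open>computes r xs z\<close> says that the computation of \<open>r\<close> on \<open>xs\<close>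
  halts with result \<open>z\<close>.
\<close>

datatype recf =
    Zero
  | Succ
  | Proj nat
  | Comp recf "recf list"
  | Prec recf recf
  | Mu recf

inductive computes :: "recf \<Rightarrow> nat list \<Rightarrow> nat \<Rightarrow> bool" where
  zero: "computes Zero xs 0"
| succ: "computes Succ [x] (Suc x)"
| proj: "i < length xs \<Longrightarrow> computes (Proj i) xs (xs ! i)"
| comp: "list_all2 (\<lambda>g y. computes g xs y) gs ys \<Longrightarrow> computes f ys z \<Longrightarrow> computes (Comp f gs) xs z"
| prec_0: "computes f xs z \<Longrightarrow> computes (Prec f g) (0 # xs) z"
| prec_Suc: "computes (Prec f g) (n # xs) y \<Longrightarrow> computes g (n # y # xs) z \<Longrightarrow>
    computes (Prec f g) (Suc n # xs) z"
| mu: "computes f (n # xs) 0 \<Longrightarrow> (\<And>m. m < n \<Longrightarrow> \<exists>y. computes f (m # xs) (Suc y)) \<Longrightarrow>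
    computes (Mu f) xs n"

inductive_cases computes_ZeroE: "computes Zero xs z"
inductive_cases computes_SuccE: "computes Succ xs z"
inductive_cases computes_ProjE: "computes (Proj i) xs z"
inductive_cases computes_CompE: "computes (Comp f gs) xs z"
inductive_cases computes_Prec_0E: "computes (Prec f g) (0 # xs) z"
inductive_cases computes_Prec_SucE: "computes (Prec f g) (Suc n # xs) z"
inductive_cases computes_MuE: "computes (Mu f) xs z"

lemma computes_deterministic:
  "computes r xs z \<Longrightarrow> computes r xs z' \<Longrightarrow> z = z'"
proof (induction arbitrary: z' rule: computes.induct)
  case (comp xs gs ys f z)
  from comp.prems obtain ys' where
    ys': "list_all2 (\<lambda>g y. computes g xs y) gs ys'" and z': "computes f ys' z'"
    by (elim computes_CompE)
  have "ys = ys'"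
    using comp.IH(1) ys' by (auto simp: list_all2_conv_all_nth intro!: nth_equalityI)
  with comp.IH(2) z' show ?case by blast
next
  case (prec_Suc f g n xs y z)
  from prec_Suc.prems obtain y' where
    "computes (Prec f g) (n # xs) y'" and "computes g (n # y' # xs) z'"
    by (elim computes_Prec_SucE)
  with prec_Suc.IH show ?case by blast
next
  case (mu f n xs)
  from mu.prems have z': "computes f (z' # xs) 0"
      "\<And>m. m < z' \<Longrightarrow> \<exists>y. computes f (m # xs) (Suc y)"
    by (auto elim: computes_MuE)
  have "\<not> n < z'" using z'(2) mu.IH(1) by fastforce
  moreover have "\<not> z' < n" using z'(1) mu.IH(2) by fastforce
  ultimately show ?case by simp
next
  case (zero xs)
  then show ?case by (elim computes_ZeroE) simp
next
  case (succ x)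
  then show ?case by (elim computes_SuccE) simp
next
  case (proj i xs)
  from proj.prems show ?case by (elim computes_ProjE) simp
next
  case (prec_0 f xs z g)
  from prec_0.prems show ?case by (elim computes_Prec_0E) (rule prec_0.IH)
qed

section \<open>Recursive functions on strings and rational numbers\<close>

text \<open>
  The type \<open>bool list\<close> is the set of finite binary strings.  It is identified with \<open>nat\<close> through
  bijective base-2 numeration (least significant digit first, digits 1 and 2).  Rational numbers are
  represented by their reduced fraction.
\<close>

fun string_code :: "bool list \<Rightarrow> nat" where
  "string_code [] = 0"
| "string_code (b # bs) = (if b then 2 else 1) + 2 * string_code bs"

lemma inj_string_code: "inj string_code"
proof (rule injI)
  fix u v :: "bool list"
  assume "string_code u = string_code v"
  then show "u = v"
  proof (induction u arbitrary: v)
    case Nil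
    then show ?case by (cases v) (simp_all split: if_splits)
  next
    case (Cons b u)
    then obtain c v' where v: "v = c # v'" by (cases v) (simp_all split: if_splits)
    have "b = c \<and> string_code u = string_code v'"
      using Cons.prems unfolding v string_code.simps by (cases b; cases c; simp; presburger)
    with Cons.IH v show ?case by simp
  qed
qed

lemma surj_string_code: "\<exists>u. string_code u = n"
proof (induction n rule: less_induct)
  case (less n)
  have "n = 0 \<or> (\<exists>k. n = 1 + 2 * k) \<or> (\<exists>k. n = 2 + 2 * k)"
    by presburger
  then consider "n = 0" | k where "n = 1 + 2 * k" | k where "n = 2 + 2 * k"
    by blast
  then show ?case
  proof cases
    case 1
    then show ?thesis by (intro exI[of _ "[]"]) simp
  next
    case (2 k)
    with less obtain u where "string_code u = k" by fastforce
    with 2 show ?thesis by (intro exI[of _ "False # u"]) simp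
  next
    case (3 k)
    with less obtain u where "string_code u = k" by fastforce
    with 3 show ?thesis by (intro exI[of _ "True # u"]) simp
  qed
qed

lemma bij_string_code: "bij string_code"
  unfolding bij_def surj_def using inj_string_code surj_string_code by metis
definition rat_code :: "rat \<Rightarrow> nat" where
  "rat_code q = (case quotient_of q of (a, b) \<Rightarrow> prod_encode (int_encode a, nat b))"

definition total_recursive :: "(nat \<Rightarrow> nat) \<Rightarrow> bool" where
  "total_recursive g \<longleftrightarrow> (\<exists>r. \<forall>n. computes r [n] (g n))"

definition total_recursive_approx :: "(bool list \<Rightarrow> bool list \<Rightarrow> nat \<Rightarrow> rat) \<Rightarrow> bool" where
  "total_recursive_approx D \<longleftrightarrow>
    (\<exists>r. \<forall>s1 s2 n. computes r [string_code s1, string_code s2, n] (rat_code (D s1 s2 n)))"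

definition recursively_approximable :: "(bool list \<Rightarrow> bool list \<Rightarrow> real) \<Rightarrow> bool" where
  "recursively_approximable h \<longleftrightarrow>
    (\<exists>D. total_recursive_approx D \<and>
      (\<forall>s1 s2 n. \<bar>h s1 s2 - of_rat (D s1 s2 n)\<bar> \<le> (1 / 2) ^ n))"

section \<open>Algorithmic information content\<close>

text \<open>
  Output strings are strings over the finite alphabet \<open>{..<a}\<close>, represented as \<open>nat list\<close>.
\<close>

definition computing_machine :: "nat \<Rightarrow> (bool list \<Rightarrow> nat list option) \<Rightarrow> bool" where
  "computing_machine a C \<longleftrightarrow>
    (\<forall>p s. C p = Some s \<longrightarrow> s \<in> lists {..<a}) \<and>
    (\<exists>r. \<forall>p z. computes r [string_code p] z \<longleftrightarrow> (\<exists>s. C p = Some s \<and> z = list_encode s))"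

definition recursive_pairing :: "(bool list \<Rightarrow> bool list \<Rightarrow> bool list) \<Rightarrow> bool" where
  "recursive_pairing pair \<longleftrightarrow>
    inj (\<lambda>(s', p). pair s' p) \<and>
    (\<exists>r. \<forall>s' p. computes r [string_code s', string_code p] (string_code (pair s' p)))"

text \<open>
  The fixed additional input \<open>w\<close> that makes \<open>U\<close> emulate \<open>C\<close> is prefixed to the program component
  of the pair, and the condition \<open>s'\<close> is left unchanged.  An additional input prefixed to the whole
  code of the pair would not bound the conditional information content.
\<close>

definition universal_machine ::
    "nat \<Rightarrow> (bool list \<Rightarrow> bool list \<Rightarrow> bool list) \<Rightarrow> (bool list \<Rightarrow> nat list option) \<Rightarrow> bool" where
  "universal_machine a pair U \<longleftrightarrow>
    computing_machine a U \<and>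
    (\<forall>C. computing_machine a C \<longrightarrow> (\<exists>w. \<forall>s' p. U (pair s' (w @ p)) = C (pair s' p)))"

text \<open>The infimum in \<open>enat\<close> is a minimum if some program outputs \<open>s\<close>, and \<open>\<infinity>\<close> otherwise.\<close>

definition AIC ::
    "(bool list \<Rightarrow> bool list \<Rightarrow> bool list) \<Rightarrow> (bool list \<Rightarrow> nat list option) \<Rightarrow>
      nat list \<Rightarrow> bool list \<Rightarrow> enat" where
  "AIC pair U s s' = (INF p\<in>{p. U (pair s' p) = Some s}. enat (length p))"

fun binary_expansion :: "nat \<Rightarrow> bool list" where
  "binary_expansion n = (if n < 2 then [n = 1] else binary_expansion (n div 2) @ [odd n])"

declare binary_expansion.simps [simp del]

text \<open>
  The output alphabet of \<open>U\<close> is fixed, whereas the symbolic orbits relative to a cover with \<open>N\<close>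
  elements are strings over \<open>{..<N}\<close> for an arbitrary \<open>N\<close>.  They are therefore written in the
  alphabet \<open>{..<a}\<close> by means of a recursive injective encoding \<open>enc N\<close>; this can be the identity for
  \<open>N \<le> a\<close>.
\<close>

definition recursive_word_encoding :: "nat \<Rightarrow> (nat \<Rightarrow> nat list \<Rightarrow> nat list) \<Rightarrow> bool" where
  "recursive_word_encoding a enc \<longleftrightarrow>
    (\<forall>N. inj_on (enc N) (lists {..<N}) \<and> enc N ` lists {..<N} \<subseteq> lists {..<a} \<and>
      (\<exists>r. \<forall>s\<in>lists {..<N}. computes r [list_encode s] (list_encode (enc N s))))"

section \<open>Orbit complexity\<close>

text \<open>A finite open cover \<open>{B\<^sub>0, \<dots>, B\<^sub>N\<^sub>-\<^sub>1}\<close> is given by the list of its elements.\<close>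

definition open_cover :: "'a::topological_space set list \<Rightarrow> bool" where
  "open_cover \<beta> \<longleftrightarrow> (\<forall>B\<in>set \<beta>. open B) \<and> \<Union>(set \<beta>) = UNIV"

definition symbolic_orbits :: "('a \<Rightarrow> 'a) \<Rightarrow> 'a set list \<Rightarrow> 'a \<Rightarrow> (nat \<Rightarrow> nat) set" where
  "symbolic_orbits T \<beta> x = {\<omega>. \<forall>n. \<omega> n < length \<beta> \<and> (T ^^ n) x \<in> \<beta> ! \<omega> n}"

definition orbit_complexity_n ::
    "(bool list \<Rightarrow> bool list \<Rightarrow> bool list) \<Rightarrow> (bool list \<Rightarrow> nat list option) \<Rightarrow>
      (nat \<Rightarrow> nat list \<Rightarrow> nat list) \<Rightarrow> 'a \<Rightarrow> ('a \<Rightarrow> 'a) \<Rightarrow> 'a set list \<Rightarrow> nat \<Rightarrow> enat" where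
  "orbit_complexity_n pair U enc x T \<beta> n =
    (INF \<omega>\<in>symbolic_orbits T \<beta> x.
      AIC pair U (enc (length \<beta>) (map \<omega> [0..<n])) (binary_expansion n))"

definition orbit_complexity_cover ::
    "(bool list \<Rightarrow> bool list \<Rightarrow> bool list) \<Rightarrow> (bool list \<Rightarrow> nat list option) \<Rightarrow>
      (nat \<Rightarrow> nat list \<Rightarrow> nat list) \<Rightarrow> (nat \<Rightarrow> real) \<Rightarrow> 'a \<Rightarrow> ('a \<Rightarrow> 'a) \<Rightarrow> 'a set list \<Rightarrow> ereal" where
  "orbit_complexity_cover pair U enc f x T \<beta> =
    limsup (\<lambda>n. ereal_of_enat (orbit_complexity_n pair U enc x T \<beta> n) / ereal (f n))"

definition orbit_complexity ::
    "(bool list \<Rightarrow> bool list \<Rightarrow> bool list) \<Rightarrow> (bool list \<Rightarrow> nat list option) \<Rightarrow>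
      (nat \<Rightarrow> nat list \<Rightarrow> nat list) \<Rightarrow> (nat \<Rightarrow> real) \<Rightarrow> 'a::topological_space \<Rightarrow> ('a \<Rightarrow> 'a) \<Rightarrow> ereal" where
  "orbit_complexity pair U enc f x T =
    (SUP \<beta>\<in>{\<beta>. open_cover \<beta>}. orbit_complexity_cover pair U enc f x T \<beta>)"

section \<open>Generalized topological entropy\<close>

definition separated_set :: "('a::metric_space \<Rightarrow> 'a) \<Rightarrow> nat \<Rightarrow> real \<Rightarrow> 'a set \<Rightarrow> bool" where
  "separated_set T n \<epsilon> E \<longleftrightarrow>
    (\<forall>x\<in>E. \<forall>y\<in>E. x \<noteq> y \<longrightarrow> (\<exists>k<n. dist ((T ^^ k) x) ((T ^^ k) y) > \<epsilon>))"

text \<open>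
  For \<open>\<epsilon> > 0\<close> the maximum exists if \<open>T\<close> is a continuous self-map of a compact space; all separated
  sets are then finite.
\<close>

definition separation_number :: "('a::metric_space \<Rightarrow> 'a) \<Rightarrow> nat \<Rightarrow> real \<Rightarrow> nat" where
  "separation_number T n \<epsilon> = Max (card ` {E. finite E \<and> separated_set T n \<epsilon> E})"

definition entropy_at :: "(nat \<Rightarrow> real) \<Rightarrow> ('a::metric_space \<Rightarrow> 'a) \<Rightarrow> real \<Rightarrow> ereal" where
  "entropy_at f T \<epsilon> = limsup (\<lambda>n. ereal (log 2 (real (separation_number T n \<epsilon>)) / f n))"

definition topological_entropy :: "(nat \<Rightarrow> real) \<Rightarrow> ('a::metric_space \<Rightarrow> 'a) \<Rightarrow> ereal" where
  "topological_entropy f T = Lim (at_right 0) (entropy_at f T)"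

section \<open>Computable structures and constructive maps\<close>

definition computable_interpretation :: "(bool list \<Rightarrow> 'a::metric_space) \<Rightarrow> bool" where
  "computable_interpretation I \<longleftrightarrow>
    closure (range I) = UNIV \<and> recursively_approximable (\<lambda>s1 s2. dist (I s1) (I s2))"

definition interpretation_equiv ::
    "((bool list \<Rightarrow> 'a::metric_space) \<times> (bool list \<Rightarrow> 'a)) set" where
  "interpretation_equiv =
    {(I1, I2). computable_interpretation I1 \<and> computable_interpretation I2 \<and>
      recursively_approximable (\<lambda>s1 s2. dist (I1 s1) (I2 s2))}"

definition computable_structure :: "(bool list \<Rightarrow> 'a::metric_space) set \<Rightarrow> bool" where
  "computable_structure \<I> \<longleftrightarrow> \<I> \<in> {I. computable_interpretation I} // interpretation_equiv"

definition constructive_morphism ::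
    "(bool list \<Rightarrow> 'a::metric_space) set \<Rightarrow> (bool list \<Rightarrow> 'b::metric_space) set \<Rightarrow>
      ('a \<Rightarrow> 'b) \<Rightarrow> bool" where
  "constructive_morphism \<I> \<J> \<Psi> \<longleftrightarrow>
    continuous_on UNIV \<Psi> \<and>
    (\<forall>I\<in>\<I>. \<forall>J\<in>\<J>. recursively_approximable (\<lambda>s1 s2. dist (\<Psi> (I s1)) (J s2)))"

definition uniformly_constructive ::
    "(bool list \<Rightarrow> 'a::metric_space) set \<Rightarrow> (bool list \<Rightarrow> 'b::metric_space) set \<Rightarrow>
      ('a \<Rightarrow> 'b) \<Rightarrow> bool" where
  "uniformly_constructive \<I> \<J> \<Psi> \<longleftrightarrow>
    constructive_morphism \<I> \<J> \<Psi> \<and>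
    (\<exists>g. total_recursive g \<and>
      (\<forall>n x y. dist x y < (1 / 2) ^ g n \<longrightarrow> dist (\<Psi> x) (\<Psi> y) < (1 / 2) ^ n))"

end

theory Submission
  imports Defs
begin

text \<open>
  By compactness a finite open cover has a Lebesgue number: for some \<open>\<eta> > 0\<close> every ball of radius
  \<open>6 * \<eta>\<close> is contained in a member of the cover.  To write down the first \<open>n\<close> symbols of a symbolic orbit of \<open>x\<close> it is therefore enough to
  name a point whose orbit stays within a few \<open>\<eta>\<close> of the orbit of \<open>x\<close> for \<open>n\<close> steps.  A maximal family
  of \<open>(n, \<eta>)\<close>-separated points contains such a point for every \<open>x\<close>, and it has at most
  \<open>s(n, \<eta>)\<close> elements; its elements can be numbered by strings of length at most
  \<open>log 2 s(n, \<eta>)\<close>.  If a machine can find the \<open>v\<close>-th element of the family from \<open>n\<close> and \<open>v\<close>, then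
  the information content of the symbols given \<open>n\<close> is at most \<open>log 2 s(n, \<eta>)\<close> plus a constant.
  Division by \<open>f n\<close> makes the constant disappear in the limit superior, which gives
  \<open>entropy_at f T \<eta>\<close>; this increases to the entropy as \<open>\<eta>\<close> decreases.

  The family has to be computed from approximate data only.  The candidates are certificates: a
  pseudo-orbit of ideal points together with a list of precisions, the nearby points of a finite net
  and the letters of the cover that belong to these.  The validity of a certificate is a decidable
  conjunction of local conditions.  The recursive modulus of continuity turns the local errors into
  a bound for the whole orbit (\<open>pseudo_orbit_shadow\<close>), and every orbit is followed by a certified
  pseudo-orbit (\<open>exists_pseudo_orbit\<close>).  Whether two certificates are separated is read off from
  their net points, hence from a finite table; no real number has to be compared exactly.  Both
  properties are collected in \<open>certified_words\<close>.

  The machine runs through all certificates and keeps those that are separated from the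
  ones kept before.  It never knows whether the last one has been found, but this does no harm: asked
  for the \<open>v\<close>-th one, it searches until \<open>v + 1\<close> are found.  The machine itself is built in
  \<open>indexed_coding\<close>, on top of closure properties of the recursive functions.
\<close>

section \<open>Total recursive functions and decidable predicates\<close>

definition recfn :: "nat \<Rightarrow> (nat list \<Rightarrow> nat) \<Rightarrow> bool" where
  "recfn k F \<longleftrightarrow> (\<exists>r. \<forall>xs. length xs = k \<longrightarrow> computes r xs (F xs))"

text \<open>
  Truth is coded by \<open>0\<close>, because unbounded search looks for a zero.
\<close>

definition decid :: "nat \<Rightarrow> (nat list \<Rightarrow> bool) \<Rightarrow> bool" where
  "decid k P \<longleftrightarrow> recfn k (\<lambda>xs. if P xs then 0 else 1)"

named_theorems recintros

lemma recfn_cong: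
  assumes "recfn k F" "\<And>xs. length xs = k \<Longrightarrow> F xs = G xs"
  shows "recfn k G"
  using assms unfolding recfn_def by metis

lemma recfn_compose:
  assumes F: "recfn (length Gs) F" and Gs: "\<And>G. G \<in> set Gs \<Longrightarrow> recfn k G"
  shows "recfn k (\<lambda>xs. F (map (\<lambda>G. G xs) Gs))"
proof -
  obtain r where r: "\<And>xs. length xs = length Gs \<Longrightarrow> computes r xs (F xs)"
    using F unfolding recfn_def by blast
  have "\<forall>G\<in>set Gs. \<exists>q. \<forall>xs. length xs = k \<longrightarrow> computes q xs (G xs)"
    using Gs unfolding recfn_def by blast
  then obtain q where q: "\<And>G xs. G \<in> set Gs \<Longrightarrow> length xs = k \<Longrightarrow> computes (q G) xs (G xs)"
    by metis
  have "computes (Comp r (map q Gs)) xs (F (map (\<lambda>G. G xs) Gs))" if "length xs = k" for xs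
  proof (rule computes.comp)
    show "list_all2 (\<lambda>g y. computes g xs y) (map q Gs) (map (\<lambda>G. G xs) Gs)"
      using q that by (simp add: list_all2_conv_all_nth)
    show "computes r (map (\<lambda>G. G xs) Gs) (F (map (\<lambda>G. G xs) Gs))"
      by (rule r) simp
  qed
  then show ?thesis unfolding recfn_def by blast
qed

text \<open>
  The outer function is given with its arguments as list entries, so that the arguments can be
  replaced by arbitrary functions of the environment without mentioning argument lists.  The rules
  for compositions with a variable function symbol have to be instantiated by hand: their
  conclusions unify with too many terms to be useful as introduction rules.
\<close>

lemma recfn_compose1:
  assumes "recfn 1 (\<lambda>xs. h (xs ! 0))" "recfn k F"
  shows "recfn k (\<lambda>xs. h (F xs))"
  using recfn_compose[of "[F]" "\<lambda>xs. h (xs ! 0)" k] assms by simp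

lemma recfn_compose2:
  assumes "recfn 2 (\<lambda>xs. h (xs ! 0) (xs ! 1))" "recfn k F" "recfn k G"
  shows "recfn k (\<lambda>xs. h (F xs) (G xs))"
  using recfn_compose[of "[F, G]" "\<lambda>xs. h (xs ! 0) (xs ! 1)" k] assms
  by (auto simp: numeral_2_eq_2)

lemma recfn_compose3:
  assumes "recfn 3 (\<lambda>xs. h (xs ! 0) (xs ! 1) (xs ! 2))" "recfn k F" "recfn k G" "recfn k H"
  shows "recfn k (\<lambda>xs. h (F xs) (G xs) (H xs))"
  using recfn_compose[of "[F, G, H]" "\<lambda>xs. h (xs ! 0) (xs ! 1) (xs ! 2)" k] assms
  by (auto simp: numeral_3_eq_3 numeral_2_eq_2)

lemma decid_compose1:
  assumes "decid 1 (\<lambda>xs. P (xs ! 0))" "recfn k F"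
  shows "decid k (\<lambda>xs. P (F xs))"
  using assms unfolding decid_def by (rule recfn_compose1)

lemma decid_compose2:
  assumes "decid 2 (\<lambda>xs. P (xs ! 0) (xs ! 1))" "recfn k F" "recfn k G"
  shows "decid k (\<lambda>xs. P (F xs) (G xs))"
  using assms unfolding decid_def by (rule recfn_compose2)

lemma decid_compose3:
  assumes "decid 3 (\<lambda>xs. P (xs ! 0) (xs ! 1) (xs ! 2))" "recfn k F" "recfn k G" "recfn k H"
  shows "decid k (\<lambda>xs. P (F xs) (G xs) (H xs))"
  using assms unfolding decid_def by (rule recfn_compose3)

lemma recfn_nth [recintros]: "i < k \<Longrightarrow> recfn k (\<lambda>xs. xs ! i)"
  unfolding recfn_def using computes.proj by blast

text \<open>
  A quantifier or a primitive recursion pushes its variables onto the front of the environment, so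
  the outer variables appear below \<open>tl\<close>.  Three levels are enough for the nesting used here.
\<close>

lemma recfn_nth_tl [recintros]: "Suc i < k \<Longrightarrow> recfn k (\<lambda>xs. tl xs ! i)"
  by (rule recfn_cong[OF recfn_nth[of "Suc i" k]]) (simp_all add: nth_tl)

lemma recfn_nth_tl_tl [recintros]: "Suc (Suc i) < k \<Longrightarrow> recfn k (\<lambda>xs. tl (tl xs) ! i)"
  by (rule recfn_cong[OF recfn_nth[of "Suc (Suc i)" k]]) (simp_all add: nth_tl)

lemma recfn_nth_tl_tl_tl [recintros]:
  "Suc (Suc (Suc i)) < k \<Longrightarrow> recfn k (\<lambda>xs. tl (tl (tl xs)) ! i)"
  by (rule recfn_cong[OF recfn_nth[of "Suc (Suc (Suc i))" k]]) (simp_all add: nth_tl)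

lemma recfn_Suc [recintros]: "recfn k F \<Longrightarrow> recfn k (\<lambda>xs. Suc (F xs))"
proof (rule recfn_compose1[where h=Suc])
  have "computes Succ xs (Suc (xs ! 0))" if "length xs = 1" for xs
    using that by (cases xs) (auto intro: computes.succ)
  then show "recfn 1 (\<lambda>xs. Suc (xs ! 0))" unfolding recfn_def by blast
qed

lemma recfn_const [recintros]: "recfn k (\<lambda>xs. c)"
proof (induction c)
  case 0
  then show ?case unfolding recfn_def using computes.zero by blast
qed (rule recfn_Suc)

text \<open>
  The recursive function \<open>h\<close> and its bound \<open>B\<close> may both depend on the whole environment, which serves
  as the list of parameters.
\<close>

lemma recfn_primrec:
  assumes F: "recfn k F" and G: "recfn (Suc (Suc k)) (\<lambda>ys. G (ys ! 0) (ys ! 1) (tl (tl ys)))"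
    and B: "recfn k B"
    and h0: "\<And>xs. h 0 xs = F xs"
    and hSuc: "\<And>n xs. h (Suc n) xs = G n (h n xs) xs"
  shows "recfn k (\<lambda>xs. h (B xs) xs)"
proof -
  obtain p where p: "\<And>xs. length xs = k \<Longrightarrow> computes p xs (F xs)"
    using F unfolding recfn_def by blast
  obtain q where q: "\<And>ys. length ys = Suc (Suc k) \<Longrightarrow>
      computes q ys (G (ys ! 0) (ys ! 1) (tl (tl ys)))"
    using G unfolding recfn_def by blast
  have "computes (Prec p q) (n # xs) (h n xs)" if "length xs = k" for n xs
  proof (induction n)
    case 0
    show ?case using p[OF that] by (simp add: h0 computes.prec_0)
  next
    case (Suc n)
    have "computes q (n # h n xs # xs) (h (Suc n) xs)"
      using q[of "n # h n xs # xs"] that by (simp add: hSuc)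
    with Suc show ?case by (rule computes.prec_Suc)
  qed
  then have "recfn (Suc k) (\<lambda>ys. h (ys ! 0) (tl ys))"
    unfolding recfn_def by (metis length_Suc_conv list.sel(3) nth_Cons_0)
  moreover have "map (\<lambda>G. G xs) (B # map (\<lambda>i xs. xs ! i) [0..<k]) = B xs # xs"
    if "length xs = k" for xs :: "nat list"
    using that by (auto intro!: nth_equalityI)
  moreover have "recfn k (\<lambda>xs. (\<lambda>ys. h (ys ! 0) (tl ys))
      (map (\<lambda>G. G xs) (B # map (\<lambda>i xs. xs ! i) [0..<k])))"
    using calculation(1) B by (intro recfn_compose) (auto intro: recfn_nth)
  ultimately show ?thesis
    by (elim recfn_cong) (simp only: nth_Cons_0 list.sel)
qed

lemma recfn_add [recintros]: "recfn k F \<Longrightarrow> recfn k G \<Longrightarrow> recfn k (\<lambda>xs. F xs + G xs)"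
  by (rule recfn_compose2[where h="(+)"])
    (rule recfn_primrec[where h="\<lambda>n xs. xs ! 0 + n" and F="\<lambda>xs. xs ! 0" and G="\<lambda>n y xs. Suc y"],
      auto intro!: recintros)

lemma recfn_mult [recintros]: "recfn k F \<Longrightarrow> recfn k G \<Longrightarrow> recfn k (\<lambda>xs. F xs * G xs)"
  by (rule recfn_compose2[where h="(*)"])
    (rule recfn_primrec[where h="\<lambda>n xs. xs ! 0 * n" and F="\<lambda>xs. 0" and G="\<lambda>n y xs. xs ! 0 + y"],
      auto intro!: recintros)

lemma recfn_power2 [recintros]: "recfn k F \<Longrightarrow> recfn k (\<lambda>xs. 2 ^ F xs)"
  by (rule recfn_compose1[where h="\<lambda>n. 2 ^ n"])
    (rule recfn_primrec[where h="\<lambda>n xs. 2 ^ n" and F="\<lambda>xs. 1" and G="\<lambda>n y xs. 2 * y"],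
      auto intro!: recintros)

lemma recfn_pred: "recfn k F \<Longrightarrow> recfn k (\<lambda>xs. F xs - 1)"
  by (rule recfn_compose1[where h="\<lambda>n. n - 1"])
    (rule recfn_primrec[where h="\<lambda>n xs. n - 1" and F="\<lambda>xs. 0" and G="\<lambda>n y xs. n"],
      auto intro!: recintros)

lemma recfn_diff [recintros]: "recfn k F \<Longrightarrow> recfn k G \<Longrightarrow> recfn k (\<lambda>xs. F xs - G xs)"
  by (rule recfn_compose2[where h="(-)"])
    (rule recfn_primrec[where h="\<lambda>n xs. xs ! 0 - n" and F="\<lambda>xs. xs ! 0" and G="\<lambda>n y xs. y - 1"],
      auto intro!: recintros recfn_pred[unfolded One_nat_def])

lemma decid_eq_0: "recfn k F \<Longrightarrow> decid k (\<lambda>xs. F xs = 0)"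
  unfolding decid_def
  by (rule recfn_cong[where F="\<lambda>xs. 1 - (1 - F xs)"]) (auto intro!: recintros)

lemma decid_le [recintros]: "recfn k F \<Longrightarrow> recfn k G \<Longrightarrow> decid k (\<lambda>xs. F xs \<le> G xs)"
  using decid_eq_0[of k "\<lambda>xs. F xs - G xs"] by (simp add: recfn_diff)

lemma decid_not [recintros]: "decid k P \<Longrightarrow> decid k (\<lambda>xs. \<not> P xs)"
  unfolding decid_def
  by (rule recfn_cong[where F="\<lambda>xs. 1 - (if P xs then 0 else 1)"]) (auto intro!: recintros)

lemma decid_conj [recintros]: "decid k P \<Longrightarrow> decid k Q \<Longrightarrow> decid k (\<lambda>xs. P xs \<and> Q xs)"
  unfolding decid_def
  by (rule recfn_cong[where F="\<lambda>xs. 1 - ((1 - (if P xs then 0 else 1)) * (1 - (if Q xs then 0 else 1)))"])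
    (auto intro!: recintros)

lemma decid_disj [recintros]: "decid k P \<Longrightarrow> decid k Q \<Longrightarrow> decid k (\<lambda>xs. P xs \<or> Q xs)"
  using decid_not[OF decid_conj[OF decid_not[of k P] decid_not[of k Q]]] by simp

lemma decid_eq [recintros]: "recfn k F \<Longrightarrow> recfn k G \<Longrightarrow> decid k (\<lambda>xs. F xs = G xs)"
  using decid_conj[OF decid_le[of k F G] decid_le[of k G F]] by (simp add: order_eq_iff)

lemma decid_False: "decid k (\<lambda>xs. False)"
  unfolding decid_def by (simp add: recfn_const)

lemma recfn_if [recintros]:
  assumes "decid k P" "recfn k F" "recfn k G"
  shows "recfn k (\<lambda>xs. if P xs then F xs else G xs)"
proof (rule recfn_cong)
  let ?p = "\<lambda>xs. if P xs then 0 else 1"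
  show "recfn k (\<lambda>xs. F xs * (1 - ?p xs) + G xs * ?p xs)"
    using assms by (auto intro!: recintros simp: decid_def)
qed auto

lemma decid_ball [recintros]:
  assumes "decid (Suc k) (\<lambda>ys. P (ys ! 0) (tl ys))" "recfn k B"
  shows "decid k (\<lambda>xs. \<forall>i<B xs. P i xs)"
  unfolding decid_def
proof (rule recfn_primrec[OF recfn_const[of k 0] _ assms(2)])
  let ?G = "\<lambda>n y xs. if y = 0 \<and> P n xs then 0 else (1::nat)"
  have "decid (Suc (Suc k)) (\<lambda>ys. P (ys ! 0) (tl (tl ys)))"
  proof -
    let ?H = "\<lambda>ys. if P (ys ! 0) (tl ys) then 0 else (1::nat)"
    let ?Gs = "(\<lambda>xs. xs ! 0) # map (\<lambda>i (xs::nat list). xs ! (i + 2)) [0..<k]"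
    have "map (\<lambda>G. G ys) ?Gs = ys ! 0 # tl (tl ys)" if "length ys = Suc (Suc k)" for ys
      using that by (auto intro!: nth_equalityI simp: nth_tl)
    moreover have "recfn (Suc (Suc k)) (\<lambda>ys. ?H (map (\<lambda>G. G ys) ?Gs))"
      using assms(1) by (intro recfn_compose) (auto simp: decid_def intro!: recintros)
    ultimately show ?thesis
      unfolding decid_def by (elim recfn_cong) (simp only: nth_Cons_0 list.sel)
  qed
  then show "recfn (Suc (Suc k)) (\<lambda>ys. ?G (ys ! 0) (ys ! 1) (tl (tl ys)))"
    by (auto intro!: recintros decid_eq_0)
qed (auto simp: less_Suc_eq)

lemma decid_bex [recintros]:
  assumes "decid (Suc k) (\<lambda>ys. P (ys ! 0) (tl ys))" "recfn k B"
  shows "decid k (\<lambda>xs. \<exists>i<B xs. P i xs)"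
  using decid_not[OF decid_ball[OF decid_not[OF assms(1)] assms(2)]] by simp

lemma decid_finite [recintros]:
  assumes "finite A" "recfn k F" "recfn k G"
  shows "decid k (\<lambda>xs. (F xs, G xs) \<in> A)"
  using assms(1)
proof induction
  case empty
  then show ?case by (simp add: decid_False)
next
  case (insert p A)
  have "decid k (\<lambda>xs. (F xs = fst p \<and> G xs = snd p) \<or> (F xs, G xs) \<in> A)"
    using insert assms by (intro recintros)
  then show ?case by (simp add: prod_eq_iff)
qed

text \<open>
  In contrast to \<open>recfn_Least\<close> no witness has to exist; then the search diverges, and it is this
  partial function that becomes a machine.
\<close>

lemma decid_search:
  assumes "decid (Suc k) (\<lambda>ys. P (ys ! 0) (tl ys))"
  shows "\<exists>r. \<forall>xs n. length xs = k \<longrightarrow>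
    (computes r xs n \<longleftrightarrow> P n xs \<and> (\<forall>m<n. \<not> P m xs))"
proof -
  obtain r where r: "\<And>ys. length ys = Suc k \<Longrightarrow>
      computes r ys (if P (ys ! 0) (tl ys) then 0 else 1)"
    using assms unfolding decid_def recfn_def by blast
  have r': "computes r (n # xs) y \<longleftrightarrow> y = (if P n xs then 0 else 1)" if "length xs = k" for n xs y
    using r[of "n # xs"] that computes_deterministic by auto
  show ?thesis
  proof (intro exI allI impI)
    fix xs :: "nat list" and n assume "length xs = k"
    then show "computes (Mu r) xs n \<longleftrightarrow> P n xs \<and> (\<forall>m<n. \<not> P m xs)"
      by (auto simp: r' split: if_splits intro!: computes.mu elim!: computes_MuE)
  qed
qed

lemma recfn_Least:
  assumes "decid (Suc k) (\<lambda>ys. P (ys ! 0) (tl ys))" "\<And>xs. length xs = k \<Longrightarrow> \<exists>n. P n xs"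
  shows "recfn k (\<lambda>xs. LEAST n. P n xs)"
proof -
  obtain r where "\<And>xs n. length xs = k \<Longrightarrow>
    computes r xs n \<longleftrightarrow> P n xs \<and> (\<forall>m<n. \<not> P m xs)"
    using decid_search[OF assms(1)] by blast
  then show ?thesis
    unfolding recfn_def by (metis LeastI assms(2) not_less_Least)
qed

section \<open>Recursive operations on pairs and lists\<close>

lemma recfn_triangle: "recfn k F \<Longrightarrow> recfn k (\<lambda>xs. triangle (F xs))"
  by (rule recfn_compose1[where h="triangle"])
    (rule recfn_primrec[where h="\<lambda>n xs. triangle n" and F="\<lambda>xs. 0" and G="\<lambda>n y xs. y + Suc n"],
      auto intro!: recintros)

lemma recfn_prod_encode [recintros]:
  "recfn k F \<Longrightarrow> recfn k G \<Longrightarrow> recfn k (\<lambda>xs. prod_encode (F xs, G xs))"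
  unfolding prod_encode_def by (simp add: recfn_add recfn_triangle)

definition pfst :: "nat \<Rightarrow> nat" where "pfst c = fst (prod_decode c)"
definition psnd :: "nat \<Rightarrow> nat" where "psnd c = snd (prod_decode c)"

lemma pfst_prod_encode [simp]: "pfst (prod_encode (x, y)) = x"
  and psnd_prod_encode [simp]: "psnd (prod_encode (x, y)) = y"
  by (simp_all add: pfst_def psnd_def)

lemma prod_encode_pfst_psnd [simp]: "prod_encode (pfst c, psnd c) = c"
  by (simp add: pfst_def psnd_def)

lemma pfst_le: "pfst c \<le> c" and psnd_le: "psnd c \<le> c"
  using le_prod_encode_1[of "pfst c" "psnd c"] le_prod_encode_2[of "psnd c" "pfst c"] by simp_all

lemma recfn_pfst [recintros]: "recfn k F \<Longrightarrow> recfn k (\<lambda>xs. pfst (F xs))"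
proof (rule recfn_compose1[where h="pfst"])
  have *: "(\<exists>n<Suc c. prod_encode (m, n) = c) \<longleftrightarrow> m = pfst c" for m c
    using psnd_le[of c] by (metis le_imp_less_Suc pfst_prod_encode prod_encode_pfst_psnd)
  have "recfn 1 (\<lambda>xs. LEAST m. \<exists>n<Suc (xs ! 0). prod_encode (m, n) = xs ! 0)"
    by (intro recfn_Least recintros) (auto simp: *)
  then show "recfn 1 (\<lambda>xs. pfst (xs ! 0))"
    by (simp add: * Least_equality)
qed

lemma recfn_psnd [recintros]: "recfn k F \<Longrightarrow> recfn k (\<lambda>xs. psnd (F xs))"
proof (rule recfn_compose1[where h="psnd"])
  have *: "(\<exists>m<Suc c. prod_encode (m, n) = c) \<longleftrightarrow> n = psnd c" for n c
    using pfst_le[of c] by (metis le_imp_less_Suc psnd_prod_encode prod_encode_pfst_psnd)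
  have "recfn 1 (\<lambda>xs. LEAST n. \<exists>m<Suc (xs ! 0). prod_encode (m, n) = xs ! 0)"
    by (intro recfn_Least recintros) (auto simp: *)
  then show "recfn 1 (\<lambda>xs. psnd (xs ! 0))"
    by (simp add: * Least_equality)
qed

text \<open>
  \<open>list_encode (x # xs)\<close> is the successor of the code of a pair, and the empty list has code \<open>0\<close>.  As
  \<open>psnd 0 = 0\<close>, dropping further elements from the empty list leaves it empty.
\<close>

definition lhd :: "nat \<Rightarrow> nat" where "lhd c = pfst (c - 1)"
definition ldrop :: "nat \<Rightarrow> nat \<Rightarrow> nat" where "ldrop k = (\<lambda>c. psnd (c - 1)) ^^ k"
definition lnth :: "nat \<Rightarrow> nat \<Rightarrow> nat" where "lnth c k = lhd (ldrop k c)"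

lemma recfn_lhd [recintros]: "recfn k F \<Longrightarrow> recfn k (\<lambda>xs. lhd (F xs))"
  unfolding lhd_def by (intro recintros)

lemma recfn_ldrop [recintros]: "recfn k F \<Longrightarrow> recfn k G \<Longrightarrow> recfn k (\<lambda>xs. ldrop (F xs) (G xs))"
  by (rule recfn_compose2[where h="ldrop"])
    (rule recfn_primrec[where h="\<lambda>n xs. ldrop n (xs ! 1)" and F="\<lambda>xs. xs ! 1"
        and G="\<lambda>n y xs. psnd (y - 1)"],
      auto intro!: recintros simp: ldrop_def)

lemma recfn_lnth [recintros]: "recfn k F \<Longrightarrow> recfn k G \<Longrightarrow> recfn k (\<lambda>xs. lnth (F xs) (G xs))"
  unfolding lnth_def by (intro recintros)

lemma lhd_list_encode [simp]: "lhd (list_encode (x # xs)) = x"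
  by (simp add: lhd_def)

lemma ldrop_list_encode: "ldrop k (list_encode xs) = list_encode (drop k xs)"
proof (induction k arbitrary: xs)
  case (Suc k)
  have "psnd 0 = 0" using psnd_le[of 0] by simp
  then have "psnd (list_encode ys - 1) = list_encode (tl ys)" for ys by (cases ys) simp_all
  with Suc show ?case by (simp add: ldrop_def drop_Suc tl_drop)
qed (simp add: ldrop_def)

lemma list_encode_eq_0 [simp]: "list_encode xs = 0 \<longleftrightarrow> xs = []"
  by (cases xs) simp_all

lemma ldrop_eq_0: "ldrop k (list_encode xs) = 0 \<longleftrightarrow> length xs \<le> k"
  by (simp add: ldrop_list_encode)

lemma lnth_list_encode: "k < length xs \<Longrightarrow> lnth (list_encode xs) k = xs ! k"
  by (simp add: lnth_def lhd_def ldrop_list_encode Cons_nth_drop_Suc[symmetric])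

section \<open>Strings, rational approximations and binary expansions\<close>

abbreviation string_of :: "nat \<Rightarrow> bool list" where "string_of \<equiv> inv string_code"

lemma string_of_code [simp]: "string_of (string_code s) = s"
  by (simp add: inj_string_code)

lemma code_string_of [simp]: "string_code (string_of n) = n"
  using surj_string_code by (metis string_of_code)

text \<open>
  Negative numerators have odd codes, and the code of a numerator \<open>i \<ge> 0\<close> is \<open>2 * i\<close>; this factor \<open>2\<close>
  is the reason for the exponent \<open>Suc e\<close> on the left and \<open>e\<close> on the right.
\<close>

lemma rat_code_le:
  "q \<le> (1 / 2) ^ Suc e \<longleftrightarrow>
    odd (pfst (rat_code q)) \<or> pfst (rat_code q) * 2 ^ e \<le> psnd (rat_code q)"
proof -
  obtain i j where ij: "quotient_of q = (i, j)" by fastforce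
  then have "j > 0" and q: "q = of_int i / of_int j"
    using quotient_of_denom_pos quotient_of_div by blast+
  have code: "pfst (rat_code q) = int_encode i" "psnd (rat_code q) = nat j"
    by (simp_all add: rat_code_def ij)
  show ?thesis
  proof (cases "i < 0")
    case True
    then have "q < 0" using q \<open>j > 0\<close> by (simp add: divide_neg_pos)
    moreover have "(0 :: rat) \<le> (1 / 2) ^ Suc e" by simp
    ultimately have "q \<le> (1 / 2) ^ Suc e" by linarith
    moreover have "odd (int_encode i)" using True by (simp add: int_encode_def sum_encode_def)
    ultimately show ?thesis by (simp add: code)
  next
    case False
    then have enc: "int_encode i = 2 * nat i" by (simp add: int_encode_def sum_encode_def)
    have "q \<le> (1 / 2) ^ Suc e \<longleftrightarrow> of_int i * 2 ^ Suc e \<le> (of_int j :: rat)"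
      using \<open>j > 0\<close> by (simp add: q field_simps)
    also have "\<dots> \<longleftrightarrow> i * 2 ^ Suc e \<le> j"
    proof -
      have "(of_int i :: rat) * 2 ^ Suc e = of_int (i * 2 ^ Suc e)" by simp
      then show ?thesis by (simp only: of_int_le_iff)
    qed
    also have "\<dots> \<longleftrightarrow> 2 * nat i * 2 ^ e \<le> nat j"
    proof -
      obtain m where "i = int m" using False by (metis int_nat_eq not_less)
      moreover obtain m' where "j = int m'" using \<open>j > 0\<close> by (metis int_nat_eq less_imp_le)
      moreover have "int m * 2 ^ Suc e \<le> int m' \<longleftrightarrow> m * 2 ^ Suc e \<le> m'"
      proof -
        have "int m * 2 ^ Suc e = int (m * 2 ^ Suc e)" by simp
        then show ?thesis by (simp only: of_nat_le_iff)
      qed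
      ultimately show ?thesis by (simp add: mult_ac)
    qed
    finally show ?thesis by (simp add: code enc)
  qed
qed

lemma decid_odd [recintros]: "recfn k F \<Longrightarrow> decid k (\<lambda>xs. odd (F xs))"
proof (rule decid_compose1[where P=odd])
  have *: "(\<exists>m<n. n = 2 * m + 1) \<longleftrightarrow> odd n" for n :: nat by presburger
  have "decid 1 (\<lambda>xs. \<exists>m<xs ! 0. xs ! 0 = 2 * m + 1)" by (intro recintros) simp_all
  then show "decid 1 (\<lambda>xs. odd (xs ! 0))" by (simp only: *)
qed

text \<open>
  The exact comparison of \<open>h\<close> with \<open>(1 / 2) ^ e\<close> need not be decidable.  A decidable predicate can
  separate the values below a quarter of the threshold from those above it: compare an
  approximation with error \<open>(1 / 2) ^ (e + 2)\<close> with the threshold's half.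
\<close>

lemma decid_approximable:
  assumes "recursively_approximable h"
  shows "\<exists>N. decid 3 (\<lambda>xs. N (xs ! 0) (xs ! 1) (xs ! 2)) \<and>
    (\<forall>u v e. N u v e \<longrightarrow> h (string_of u) (string_of v) < (1 / 2) ^ e) \<and>
    (\<forall>u v e. h (string_of u) (string_of v) \<le> (1 / 2) ^ (e + 2) \<longrightarrow> N u v e)"
proof -
  obtain D where D: "total_recursive_approx D"
    and approx: "\<And>s1 s2 n. \<bar>h s1 s2 - of_rat (D s1 s2 n)\<bar> \<le> (1 / 2) ^ n"
    using assms unfolding recursively_approximable_def by blast
  define d where "d u v e = D (string_of u) (string_of v) (e + 2)" for u v e
  obtain r where r: "\<And>s1 s2 n. computes r [string_code s1, string_code s2, n] (rat_code (D s1 s2 n))"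
    using D unfolding total_recursive_approx_def by blast
  have "computes r xs (rat_code (D (string_of (xs ! 0)) (string_of (xs ! 1)) (xs ! 2)))"
    if "length xs = 3" for xs
    using that r[of "string_of (xs ! 0)" "string_of (xs ! 1)" "xs ! 2"]
    by (auto simp: numeral_3_eq_3 numeral_2_eq_2 length_Suc_conv)
  then have "recfn 3 (\<lambda>xs. rat_code (D (string_of (xs ! 0)) (string_of (xs ! 1)) (xs ! 2)))"
    unfolding recfn_def by blast
  then have "recfn 3 (\<lambda>xs. rat_code (D (string_of (xs ! 0)) (string_of (xs ! 1)) (xs ! 2 + 2)))"
    by (rule recfn_compose3[where h="\<lambda>u v e. rat_code (D (string_of u) (string_of v) e)"])
      (intro recintros; simp)+
  then have rec: "recfn 3 (\<lambda>xs. rat_code (d (xs ! 0) (xs ! 1) (xs ! 2)))"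
    by (simp add: d_def)
  define N where "N u v e \<longleftrightarrow> d u v e \<le> (1 / 2) ^ Suc e" for u v e
  have N: "N u v e \<longleftrightarrow> of_rat (d u v e) \<le> (1 / 2 :: real) ^ Suc e" for u v e
  proof -
    have "(of_rat ((1 / 2) ^ Suc e) :: real) = (1 / 2) ^ Suc e"
      by (simp add: of_rat_power of_rat_divide)
    then show ?thesis unfolding N_def by (metis of_rat_less_eq)
  qed
  have d: "\<bar>h (string_of u) (string_of v) - of_rat (d u v e)\<bar> \<le> (1 / 2) ^ (e + 2)" for u v e
    unfolding d_def by (rule approx)
  have pow: "(1 / 2 :: real) ^ (e + 2) = (1 / 2) ^ e / 4" "(1 / 2 :: real) ^ Suc e = (1 / 2) ^ e / 2"
    "(1 / 2 :: real) ^ e > 0" for e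
    by simp_all
  show ?thesis
  proof (intro exI[of _ N] conjI allI impI)
    show "decid 3 (\<lambda>xs. N (xs ! 0) (xs ! 1) (xs ! 2))"
      unfolding N_def rat_code_le by (intro recintros rec) simp
    show "h (string_of u) (string_of v) < (1 / 2) ^ e" if "N u v e" for u v e
      using that d[of u v e] pow[of e] unfolding N by linarith
    show "N u v e" if "h (string_of u) (string_of v) \<le> (1 / 2) ^ (e + 2)" for u v e
      using that d[of u v e] pow[of e] unfolding N by linarith
  qed
qed

definition binary_value :: "bool list \<Rightarrow> nat" where
  "binary_value = foldl (\<lambda>m b. 2 * m + of_bool b) 0"

lemma binary_value_append: "binary_value (bs @ [b]) = 2 * binary_value bs + of_bool b"
  by (simp add: binary_value_def)

lemma binary_value_expansion: "binary_value (binary_expansion n) = n"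
proof (induction n rule: less_induct)
  case (less n)
  show ?case
  proof (cases "n < 2")
    case True
    then show ?thesis by (subst binary_expansion.simps) (auto simp: binary_value_def)
  next
    case False
    then have "binary_value (binary_expansion n) = 2 * (n div 2) + of_bool (odd n)"
      using less[of "n div 2"] by (subst binary_expansion.simps) (simp add: binary_value_append)
    then show ?thesis by simp
  qed
qed

lemma length_le_string_code: "length bs \<le> string_code bs"
  by (induction bs) auto

text \<open>
  On codes, removing the first bit is \<open>u \<mapsto> (u - 1) div 2\<close>, and the removed bit is \<open>1\<close> iff \<open>u > 0\<close> is even.
  The most significant bit comes first, so the bits can be processed from the front by a primitive
  recursion.  The code of a string bounds its length and hence the number of steps.
\<close>

lemma recfn_binary_value: "recfn k F \<Longrightarrow> recfn k (\<lambda>xs. binary_value (string_of (F xs)))"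
proof (rule recfn_compose1[where h="\<lambda>u. binary_value (string_of u)"])
  define tail where "tail u = (u - 1) div 2" for u :: nat
  have ex: "\<exists>m. u \<le> 2 * m + 2" for u :: nat
    by (rule exI[of _ u]) simp
  have "recfn 1 (\<lambda>xs. LEAST m. xs ! 0 \<le> 2 * m + 2)"
    by (intro recfn_Least recintros) ((rule ex | simp)+)
  moreover have "(LEAST m. u \<le> 2 * m + 2) = tail u" for u
    unfolding tail_def by (rule Least_equality) linarith+
  ultimately have "recfn 1 (\<lambda>xs. tail (xs ! 0))" by simp
  note recfn_tail = recfn_compose1[where h=tail, OF this]
  have "tail (string_code bs) = string_code (tl bs)" for bs
    by (cases bs) (auto simp: tail_def)
  then have tail_code: "(tail ^^ i) (string_code bs) = string_code (drop i bs)" for i bs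
    by (induction i) (simp_all add: drop_Suc tl_drop)
  have recfn_tails: "recfn k (\<lambda>xs. (tail ^^ F xs) (G xs))" if "recfn k F" "recfn k G" for k F G
    by (rule recfn_compose2[where h="\<lambda>i. tail ^^ i", OF _ that])
      (rule recfn_primrec[where h="\<lambda>n xs. (tail ^^ n) (xs ! 1)" and F="\<lambda>xs. xs ! 1"
        and G="\<lambda>n y xs. tail y"], auto intro!: recintros recfn_tail)
  define prefix_value where "prefix_value i u = binary_value (take i (string_of u))" for i u
  have value_Suc: "prefix_value (Suc i) u = (if (tail ^^ i) u = 0 then prefix_value i u
      else 2 * prefix_value i u + (if odd ((tail ^^ i) u) then 0 else 1))" for i u
  proof -
    obtain bs where bs: "u = string_code bs" using surj_string_code by metis
    show ?thesis
    proof (cases "i < length bs")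
      case True
      then have "prefix_value (Suc i) u = 2 * prefix_value i u + of_bool (bs ! i)"
        by (simp add: bs prefix_value_def take_Suc_conv_app_nth binary_value_append)
      moreover have "(tail ^^ i) u = (if bs ! i then 2 else 1) + 2 * string_code (drop (Suc i) bs)"
        by (simp add: bs tail_code Cons_nth_drop_Suc[OF True, symmetric])
      ultimately show ?thesis by simp
    qed (simp add: bs prefix_value_def tail_code)
  qed
  have "recfn 1 (\<lambda>xs. prefix_value (xs ! 0) (xs ! 0))"
    by (rule recfn_primrec[where h="\<lambda>n xs. prefix_value n (xs ! 0)" and F="\<lambda>xs. 0"
        and G="\<lambda>i y xs. if (tail ^^ i) (xs ! 0) = 0 then y
          else 2 * y + (if odd ((tail ^^ i) (xs ! 0)) then 0 else 1)"])
      (auto intro!: recintros recfn_tails simp: value_Suc, simp add: prefix_value_def binary_value_def)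
  moreover have "prefix_value u u = binary_value (string_of u)" for u
    using length_le_string_code[of "string_of u"] by (simp add: prefix_value_def)
  ultimately show "recfn 1 (\<lambda>xs. binary_value (string_of (xs ! 0)))" by simp
qed

lemma two_power_length_le: "2 ^ length s \<le> string_code s + 1"
  by (induction s) auto

lemma length_string_of_le: "real (length (string_of v)) \<le> log 2 (real (v + 1))"
proof -
  have "2 ^ length (string_of v) \<le> v + 1" using two_power_length_le[of "string_of v"] by simp
  then have "log 2 (real (2 ^ length (string_of v))) \<le> log 2 (real (v + 1))"
    by (subst log_le_cancel_iff) (simp_all del: of_nat_power)
  then show ?thesis by simp
qed

section \<open>Information content of indexed objects\<close>

text \<open>
  The machine receives \<open>pair s' p\<close>, searches for the numbers \<open>u\<close>, \<open>v\<close> that code \<open>s'\<close> and \<open>p\<close> together with a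
  number \<open>t\<close> that is related by \<open>Q\<close> to \<open>v\<close> and to the value of \<open>s'\<close> as a binary number, and outputs the
  object with code \<open>t\<close>.  It thus treats the program as the index \<open>v\<close>.  If \<open>s'\<close> is the binary expansion of
  \<open>n\<close> then this value is \<open>n\<close>, and the emulation of the machine costs only the constant \<open>c\<close>.
\<close>

lemma indexed_coding:
  assumes pairing: "recursive_pairing pair"
    and universal: "universal_machine a pair U"
    and Q: "decid 3 (\<lambda>xs. Q (xs ! 0) (xs ! 1) (xs ! 2))"
    and r: "\<And>n v t. Q n v t \<Longrightarrow> h t \<in> lists {..<a} \<and> computes r [t] (list_encode (h t))"
    and unique: "\<And>n v t t'. Q n v t \<Longrightarrow> Q n v t' \<Longrightarrow> t = t'"
  shows "\<exists>c. \<forall>n v t. Q n v t \<longrightarrow>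
    AIC pair U (h t) (binary_expansion n) \<le> enat (c + length (string_of v))"
proof -
  obtain rp where rp: "\<And>s' p. computes rp [string_code s', string_code p] (string_code (pair s' p))"
    and inj: "inj (\<lambda>(s', p). pair s' p)"
    using pairing unfolding recursive_pairing_def by blast
  define pc where "pc u v = string_code (pair (string_of u) (string_of v))" for u v
  have "computes rp xs (pc (xs ! 0) (xs ! 1))" if "length xs = 2" for xs
    using that rp[of "string_of (xs ! 0)" "string_of (xs ! 1)"]
    by (auto simp: pc_def numeral_2_eq_2 length_Suc_conv)
  then have "recfn 2 (\<lambda>xs. pc (xs ! 0) (xs ! 1))" unfolding recfn_def by blast
  note recfn_pc = recfn_compose2[where h=pc, OF this]
  note Q' = decid_compose3[where P=Q, OF Q]
  have pc_inj: "u = u' \<and> v = v'" if "pc u v = pc u' v'" for u v u' v'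
  proof -
    have "pair (string_of u) (string_of v) = pair (string_of u') (string_of v')"
      using that inj_string_code by (simp add: pc_def inj_eq)
    then have "string_of u = string_of u' \<and> string_of v = string_of v'"
      using injD[OF inj, of "(string_of u, string_of v)" "(string_of u', string_of v')"] by simp
    then show ?thesis by (metis code_string_of)
  qed
  \<comment> \<open>\<open>j\<close> codes the triple \<open>(u, v, t)\<close> that is searched for on the input with code \<open>x\<close>\<close>
  define K where "K j x \<longleftrightarrow> x = pc (pfst j) (pfst (psnd j)) \<and>
    Q (binary_value (string_of (pfst j))) (pfst (psnd j)) (psnd (psnd j))" for j x
  have "decid (Suc 1) (\<lambda>ys. K (ys ! 0) (tl ys ! 0))"
    unfolding K_def by (intro recintros recfn_pc Q' recfn_binary_value) simp_all
  then have "\<exists>r. \<forall>xs j. length xs = 1 \<longrightarrow>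
      (computes r xs j \<longleftrightarrow> K j (xs ! 0) \<and> (\<forall>m<j. \<not> K m (xs ! 0)))"
    by (rule decid_search)
  then obtain search where
    "\<forall>xs j. length xs = 1 \<longrightarrow>
      (computes search xs j \<longleftrightarrow> K j (xs ! 0) \<and> (\<forall>m<j. \<not> K m (xs ! 0)))" ..
  then have search: "computes search [x] j \<longleftrightarrow> K j x \<and> (\<forall>m<j. \<not> K m x)" for x j
    by (auto dest!: spec[of _ "[x]"])
  have "recfn 1 (\<lambda>xs. psnd (psnd (xs ! 0)))" by (intro recintros) simp
  then obtain proj where "\<forall>xs. length xs = 1 \<longrightarrow> computes proj xs (psnd (psnd (xs ! 0)))"
    unfolding recfn_def ..
  then have proj: "computes proj [j] (psnd (psnd j))" for j
    by (auto dest!: spec[of _ "[j]"])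
  have K_unique: "j = j'" if K: "K j x" "K j' x" for j j' x
  proof -
    have "pfst j = pfst j'" "pfst (psnd j) = pfst (psnd j')"
      using K pc_inj unfolding K_def by blast+
    moreover from this have "psnd (psnd j) = psnd (psnd j')"
      using K unique unfolding K_def by metis
    ultimately show ?thesis by (metis prod_encode_pfst_psnd)
  qed
  define C where "C p = (if \<exists>j. K j (string_code p)
    then Some (h (psnd (psnd (THE j. K j (string_code p))))) else None)" for p
  have C_Some: "C p = Some (h (psnd (psnd j)))" if "K j (string_code p)" for j p
    using that K_unique by (auto simp: C_def intro!: arg_cong[where f=h] arg_cong[where f=psnd] the_equality)
  have C_E: "\<exists>j. K j (string_code p) \<and> s = h (psnd (psnd j))" if "C p = Some s" for p s
    using that C_Some unfolding C_def by (metis option.distinct(1) option.inject)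
  have "computing_machine a C"
    unfolding computing_machine_def
  proof (intro conjI allI impI)
    fix p s assume "C p = Some s"
    then show "s \<in> lists {..<a}" using C_E r unfolding K_def by metis
  next
    have "computes (Comp r [Comp proj [search]]) [string_code p] z \<longleftrightarrow>
        (\<exists>s. C p = Some s \<and> z = list_encode s)" for p z
    proof
      assume "computes (Comp r [Comp proj [search]]) [string_code p] z"
      then obtain y where y: "computes (Comp proj [search]) [string_code p] y" and z: "computes r [y] z"
        by (elim computes_CompE) (auto simp: list_all2_Cons1)
      from y obtain j where j: "computes search [string_code p] j" and "computes proj [j] y"
        by (elim computes_CompE) (auto simp: list_all2_Cons1)
      then have y: "y = psnd (psnd j)" using proj computes_deterministic by blast
      have K: "K j (string_code p)" using j search by blast
      then have "computes r [y] (list_encode (h y))" using r y unfolding K_def by blast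
      with z have "z = list_encode (h y)" using computes_deterministic by blast
      then show "\<exists>s. C p = Some s \<and> z = list_encode s" using C_Some[OF K] y by blast
    next
      assume "\<exists>s. C p = Some s \<and> z = list_encode s"
      then obtain j where K: "K j (string_code p)" and z: "z = list_encode (h (psnd (psnd j)))"
        using C_E by blast
      have "computes search [string_code p] j"
        using K K_unique search by blast
      then have "computes (Comp proj [search]) [string_code p] (psnd (psnd j))"
        using proj by (auto intro!: computes.comp)
      moreover have "computes r [psnd (psnd j)] z" using r K z unfolding K_def by blast
      ultimately show "computes (Comp r [Comp proj [search]]) [string_code p] z"
        by (auto intro!: computes.comp)
    qed
    then show "\<exists>r. \<forall>p z. computes r [string_code p] z \<longleftrightarrow> (\<exists>s. C p = Some s \<and> z = list_encode s)"
      by blast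
  qed
  then obtain w where w: "\<And>s' p. U (pair s' (w @ p)) = C (pair s' p)"
    using universal unfolding universal_machine_def by blast
  show ?thesis
  proof (intro exI[of _ "length w"] allI impI)
    fix n v t assume "Q n v t"
    then have "K (prod_encode (string_code (binary_expansion n), prod_encode (v, t)))
        (string_code (pair (binary_expansion n) (string_of v)))"
      by (simp add: K_def pc_def binary_value_expansion)
    then have "U (pair (binary_expansion n) (w @ string_of v)) = Some (h t)"
      using C_Some w by fastforce
    then have "AIC pair U (h t) (binary_expansion n) \<le> enat (length (w @ string_of v))"
      unfolding AIC_def by (intro INF_lower) simp
    then show "AIC pair U (h t) (binary_expansion n) \<le> enat (length w + length (string_of v))"
      by simp
  qed
qed

section \<open>Greedy enumeration of a separated family\<close>

text \<open>
  The latest member comes first and members are never removed, so the position counted from the end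
  is a permanent index.
\<close>

primrec greedy :: "(nat \<Rightarrow> bool) \<Rightarrow> (nat \<Rightarrow> nat \<Rightarrow> bool) \<Rightarrow> nat \<Rightarrow> nat list" where
  "greedy V S 0 = []"
| "greedy V S (Suc t) =
    (if V t \<and> (\<forall>t'\<in>set (greedy V S t). S t t') then t # greedy V S t else greedy V S t)"

lemma greedy_less: "t' \<in> set (greedy V S t) \<Longrightarrow> t' < t"
  by (induction t) (auto split: if_splits)

lemma greedy_valid: "t' \<in> set (greedy V S t) \<Longrightarrow> V t'"
  by (induction t) (auto split: if_splits)

lemma distinct_greedy: "distinct (greedy V S t)"
  by (induction t) (auto dest: greedy_less)

lemma greedy_separated:
  "t1 \<in> set (greedy V S t) \<Longrightarrow> t2 \<in> set (greedy V S t) \<Longrightarrow> t1 \<noteq> t2 \<Longrightarrow> S t1 t2 \<or> S t2 t1"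
  by (induction t) (auto split: if_splits)

text \<open>
  This is maximality at a finite stage: each \<open>t\<close> is dealt with as soon as it has been examined, even
  if members continue to be found later.
\<close>

lemma greedy_maximal:
  assumes "V t"
  shows "\<exists>t'\<in>set (greedy V S (Suc t)). t' = t \<or> \<not> S t t'"
  using assms by auto

text \<open>
  Thus a member \<open>t'\<close> is characterised by its rank \<open>length l\<close> in the enumeration, which is smaller than
  the length of every list that contains it.
\<close>

lemma greedy_stage:
  assumes "t' \<in> set (greedy V S t)"
  shows "\<exists>l. greedy V S (Suc t') = t' # l \<and> length l < length (greedy V S t)"
  using assms
proof (induction t)
  case (Suc t)
  show ?case
  proof (cases "t' \<in> set (greedy V S t)")
    case True
    with Suc.IH obtain l where "greedy V S (Suc t') = t' # l" "length l < length (greedy V S t)"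
      by blast
    moreover have "length (greedy V S t) \<le> length (greedy V S (Suc t))" by simp
    ultimately show ?thesis by (metis order_less_le_trans)
  next
    case False
    then show ?thesis using Suc.prems by (auto split: if_splits)
  qed
qed simp

lemma greedy_mono: "t \<le> t' \<Longrightarrow> length (greedy V S t) \<le> length (greedy V S t')"
  by (induction rule: dec_induct) auto

lemma length_le_list_encode: "length l \<le> list_encode l"
proof (induction l)
  case (Cons x l)
  then show ?case using le_prod_encode_2[of "list_encode l" x] by simp
qed simp

text \<open>
  The recursion is on the code of the list.  To let a number bound the positions of a list, the code
  is used in place of the length, and the positions beyond the end are skipped.
\<close>

lemma recfn_greedy:
  assumes V: "decid 2 (\<lambda>xs. V (xs ! 0) (xs ! 1))"
    and S: "decid 3 (\<lambda>xs. S (xs ! 0) (xs ! 1) (xs ! 2))"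
    and "recfn k F" "recfn k G"
  shows "recfn k (\<lambda>xs. list_encode (greedy (V (F xs)) (S (F xs)) (G xs)))"
proof (rule recfn_compose2[where h="\<lambda>n t. list_encode (greedy (V n) (S n) t)", OF _ assms(3,4)])
  have *: "(\<forall>i<list_encode l. ldrop i (list_encode l) = 0 \<or> P (lnth (list_encode l) i)) \<longleftrightarrow>
      (\<forall>t\<in>set l. P t)" for l P
  proof
    assume L: "\<forall>i<list_encode l. ldrop i (list_encode l) = 0 \<or> P (lnth (list_encode l) i)"
    show "\<forall>t\<in>set l. P t"
    proof
      fix t assume "t \<in> set l"
      then obtain i where "i < length l" "l ! i = t" by (auto simp: in_set_conv_nth)
      with L[rule_format, of i] length_le_list_encode[of l] show "P t"
        by (simp add: ldrop_eq_0 lnth_list_encode)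
    qed
  next
    assume "\<forall>t\<in>set l. P t"
    then show "\<forall>i<list_encode l. ldrop i (list_encode l) = 0 \<or> P (lnth (list_encode l) i)"
      by (metis ldrop_eq_0 lnth_list_encode not_le nth_mem)
  qed
  note V' = decid_compose2[where P=V, OF V] and S' = decid_compose3[where P=S, OF S]
  show "recfn 2 (\<lambda>xs. list_encode (greedy (V (xs ! 0)) (S (xs ! 0)) (xs ! 1)))"
    by (rule recfn_primrec[where h="\<lambda>t xs. list_encode (greedy (V (xs ! 0)) (S (xs ! 0)) t)"
        and F="\<lambda>xs. 0" and G="\<lambda>t y xs. if V (xs ! 0) t \<and>
          (\<forall>i<y. ldrop i y = 0 \<or> S (xs ! 0) t (lnth y i)) then Suc (prod_encode (t, y)) else y"])
      (auto intro!: recintros V' S' simp: *)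
qed

lemma greedy_rank_unique:
  assumes "greedy V S (Suc t) = t # l" "greedy V S (Suc t') = t' # l'" "length l = length l'"
  shows "t = t'"
proof -
  have less: False if "t1 < t2" "greedy V S (Suc t1) = t1 # l1" "greedy V S (Suc t2) = t2 # l2"
    "length l1 = length l2" for t1 t2 l1 l2
  proof -
    have "t2 \<notin> set (greedy V S t2)" using greedy_less by blast
    then have "greedy V S t2 = l2" using that(3) by (auto split: if_splits)
    then have "length (greedy V S (Suc t1)) \<le> length l2"
      using greedy_mono[of "Suc t1" t2 V S] that(1) by simp
    then show False using that(2,4) by simp
  qed
  show ?thesis using assms less by (metis nat_neq_iff)
qed

lemma decid_greedy_rank:
  assumes V: "decid 2 (\<lambda>xs. V (xs ! 0) (xs ! 1))"
    and S: "decid 3 (\<lambda>xs. S (xs ! 0) (xs ! 1) (xs ! 2))"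
  shows "decid 3 (\<lambda>xs. \<exists>l. greedy (V (xs ! 0)) (S (xs ! 0)) (Suc (xs ! 2)) = xs ! 2 # l \<and>
    length l = xs ! 1)"
proof -
  have *: "(\<exists>l. g = t # l \<and> length l = v) \<longleftrightarrow> \<not> ldrop v (list_encode g) = 0 \<and>
    ldrop (Suc v) (list_encode g) = 0 \<and> lhd (list_encode g) = t" for g t v
  proof (cases g)
    case (Cons t' l)
    then show ?thesis by (auto simp only: ldrop_eq_0 lhd_list_encode) auto
  qed (use ldrop_eq_0[of v "[]"] in simp)
  show ?thesis
    unfolding * by (intro recintros recfn_greedy[where V=V and S=S] V S) simp_all
qed

section \<open>Separated sets and entropy\<close>

lemma open_Bowen_ball:
  fixes T :: "'a::metric_space \<Rightarrow> 'a"
  assumes "continuous_on UNIV T"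
  shows "open {z. \<forall>k<n. dist ((T ^^ k) z) ((T ^^ k) y) < r}"
proof -
  have T: "continuous_on UNIV (T ^^ k)" for k
  proof (induction k)
    case (Suc k)
    have "continuous_on UNIV (T \<circ> (T ^^ k))"
      using Suc assms by (intro continuous_on_compose) (auto intro: continuous_on_subset)
    then show ?case by (simp add: o_def)
  qed (simp add: id_def)
  have "open (\<Inter>k\<in>{..<n}. {z. dist ((T ^^ k) z) ((T ^^ k) y) < r})"
    by (intro open_INT ballI open_Collect_less continuous_intros T) simp
  moreover have "(\<Inter>k\<in>{..<n}. {z. dist ((T ^^ k) z) ((T ^^ k) y) < r}) =
      {z. \<forall>k<n. dist ((T ^^ k) z) ((T ^^ k) y) < r}"
    by auto
  ultimately show ?thesis by simp
qed

text \<open>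
  An open Bowen ball of radius \<open>\<epsilon> / 2\<close> contains at most one point of a separated set, and finitely many of
  these balls cover the space.  As \<open>card\<close> of an infinite set is \<open>0\<close>, this is a statement about the
  finite separated sets.
\<close>

lemma bounded_separated_sets:
  fixes T :: "'a::metric_space \<Rightarrow> 'a"
  assumes "compact (UNIV :: 'a set)" "continuous_on UNIV T" "\<epsilon> > 0"
  shows "\<exists>M. \<forall>E. separated_set T n \<epsilon> E \<longrightarrow> card E \<le> M"
proof -
  define B where "B y = {z. \<forall>k<n. dist ((T ^^ k) z) ((T ^^ k) y) < \<epsilon> / 2}" for y
  have "open (B y)" for y unfolding B_def by (rule open_Bowen_ball[OF assms(2)])
  moreover have "y \<in> B y" for y using \<open>\<epsilon> > 0\<close> by (simp add: B_def)
  then have "UNIV \<subseteq> (\<Union>y. B y)" by blast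
  ultimately obtain C where C: "finite C" "UNIV \<subseteq> (\<Union>y\<in>C. B y)"
    using compactE_image[OF assms(1), of UNIV B] by metis
  then obtain c where c: "\<And>z. c z \<in> C \<and> z \<in> B (c z)" by (metis UNIV_I UN_E subset_iff)
  show ?thesis
  proof (intro exI allI impI)
    fix E assume sep: "separated_set T n \<epsilon> E"
    have "inj_on c E"
    proof (rule inj_onI, rule ccontr)
      fix y z assume "y \<in> E" "z \<in> E" "c y = c z" "y \<noteq> z"
      then obtain k where k: "k < n" "dist ((T ^^ k) y) ((T ^^ k) z) > \<epsilon>"
        using sep unfolding separated_set_def by blast
      moreover have "dist ((T ^^ k) y) ((T ^^ k) (c y)) < \<epsilon> / 2"
        and "dist ((T ^^ k) z) ((T ^^ k) (c y)) < \<epsilon> / 2"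
        using c[of y] c[of z] k \<open>c y = c z\<close> by (auto simp: B_def)
      ultimately show False by (smt (verit) dist_triangle2 field_sum_of_halves)
    qed
    then show "card E \<le> card C" using C(1) c by (metis card_inj_on_le image_subsetI)
  qed
qed

context
  fixes T :: "'a::metric_space \<Rightarrow> 'a"
  assumes compact: "compact (UNIV :: 'a set)" and cont: "continuous_on UNIV T"
begin

lemma finite_separated_cards:
  assumes "\<epsilon> > 0"
  shows "finite (card ` {E. finite E \<and> separated_set T n \<epsilon> E})"
proof -
  obtain M where "\<And>E. separated_set T n \<epsilon> E \<Longrightarrow> card E \<le> M"
    using bounded_separated_sets[OF compact cont assms, of n] by blast
  then show ?thesis by (intro finite_subset[OF _ finite_atMost[of M]]) auto
qed

lemma card_le_separation_number:
  "\<epsilon> > 0 \<Longrightarrow> finite E \<Longrightarrow> separated_set T n \<epsilon> E \<Longrightarrow> card E \<le> separation_number T n \<epsilon>"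
  unfolding separation_number_def by (intro Max_ge finite_separated_cards) auto

lemma separation_number_pos: "\<epsilon> > 0 \<Longrightarrow> separation_number T n \<epsilon> \<ge> 1"
  using card_le_separation_number[of \<epsilon> "{undefined}" n] by (simp add: separated_set_def)

lemma separation_number_antimono:
  assumes "0 < \<epsilon>" "\<epsilon> \<le> \<delta>"
  shows "separation_number T n \<delta> \<le> separation_number T n \<epsilon>"
  unfolding separation_number_def
proof (rule Max_mono)
  have "separated_set T n \<epsilon> E" if "separated_set T n \<delta> E" for E
    using that assms(2) unfolding separated_set_def by (meson order_le_less_trans)
  then show "card ` {E. finite E \<and> separated_set T n \<delta> E} \<subseteq> card ` {E. finite E \<and> separated_set T n \<epsilon> E}"
    by blast
  have "{} \<in> {E. finite E \<and> separated_set T n \<delta> E}" by (simp add: separated_set_def)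
  then show "card ` {E. finite E \<and> separated_set T n \<delta> E} \<noteq> {}" by blast
qed (rule finite_separated_cards[OF assms(1)])

lemma entropy_at_antimono:
  assumes "filterlim f at_top sequentially" "0 < \<epsilon>" "\<epsilon> \<le> \<delta>"
  shows "entropy_at f T \<delta> \<le> entropy_at f T \<epsilon>"
  unfolding entropy_at_def
proof (rule Limsup_mono)
  have "eventually (\<lambda>n. f n > 0) sequentially"
    using assms(1) by (simp add: filterlim_at_top_dense)
  then show "\<forall>\<^sub>F n in sequentially. ereal (log 2 (real (separation_number T n \<delta>)) / f n) \<le>
      ereal (log 2 (real (separation_number T n \<epsilon>)) / f n)"
  proof eventually_elim
    case (elim n)
    have "separation_number T n \<delta> \<ge> 1" using assms by (intro separation_number_pos) simp
    with separation_number_antimono[OF assms(2,3), of n]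
    have "log 2 (real (separation_number T n \<delta>)) \<le> log 2 (real (separation_number T n \<epsilon>))"
      by simp
    with elim show ?case by (simp add: divide_right_mono)
  qed
qed

text \<open>
  By monotonicity the limit that defines the entropy is a supremum.
\<close>

lemma entropy_at_le_topological_entropy:
  assumes "filterlim f at_top sequentially" "\<epsilon> > 0"
  shows "entropy_at f T \<epsilon> \<le> topological_entropy f T"
proof -
  let ?s = "SUP \<delta>\<in>{0<..}. entropy_at f T \<delta>"
  have "(entropy_at f T \<longlongrightarrow> ?s) (at_right 0)"
  proof (rule increasing_tendsto)
    show "\<forall>\<^sub>F \<delta> in at_right 0. entropy_at f T \<delta> \<le> ?s"
      by (rule eventually_at_rightI[of 0 1]) (auto intro: SUP_upper)
  next
    fix l assume "l < ?s"
    then obtain \<delta> where \<delta>: "\<delta> > 0" "l < entropy_at f T \<delta>" by (auto simp: less_SUP_iff)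
    have "l < entropy_at f T \<delta>'" if "0 < \<delta>'" "\<delta>' < \<delta>" for \<delta>'
      using \<delta>(2) entropy_at_antimono[OF assms(1) that(1), of \<delta>] that(2) by simp
    then show "\<forall>\<^sub>F \<delta>' in at_right 0. l < entropy_at f T \<delta>'"
      using \<delta>(1) by (intro eventually_at_rightI[of 0 \<delta>]) auto
  qed
  then have "topological_entropy f T = ?s"
    unfolding topological_entropy_def by (intro tendsto_Lim) simp_all
  then show ?thesis using assms(2) by (auto intro: SUP_upper)
qed

end

text \<open>
  The points \<open>P t\<close> for the members \<open>t\<close> of the list are pairwise distinct and form a separated set.
\<close>

lemma length_greedy_le_separation_number:
  fixes T :: "'a::metric_space \<Rightarrow> 'a"
  assumes "compact (UNIV :: 'a set)" "continuous_on UNIV T" "\<eta> > 0"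
    and sep: "\<And>t t'. V t \<Longrightarrow> V t' \<Longrightarrow> S t t' \<Longrightarrow> \<exists>k<n. dist ((T ^^ k) (P t)) ((T ^^ k) (P t')) > \<eta>"
  shows "length (greedy V S t) \<le> separation_number T n \<eta>"
proof -
  let ?G = "set (greedy V S t)"
  have far: "\<exists>k<n. dist ((T ^^ k) (P t1)) ((T ^^ k) (P t2)) > \<eta>"
    if "t1 \<in> ?G" "t2 \<in> ?G" "t1 \<noteq> t2" for t1 t2
    using greedy_separated[OF that] sep greedy_valid[OF that(1)] greedy_valid[OF that(2)]
    by (metis dist_commute)
  have "inj_on P ?G" using far \<open>\<eta> > 0\<close> by (intro inj_onI) (metis dist_self not_less_iff_gr_or_eq)
  then have "length (greedy V S t) = card (P ` ?G)"
    by (simp add: card_image distinct_card distinct_greedy)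
  moreover have "separated_set T n \<eta> (P ` ?G)"
    using far unfolding separated_set_def by blast
  ultimately show ?thesis
    using card_le_separation_number[OF assms(1-3), of "P ` ?G"] by simp
qed

lemma limsup_bounded_by_entropy:
  fixes T :: "'a::metric_space \<Rightarrow> 'a"
  assumes f: "filterlim f at_top sequentially"
    and le: "\<And>n. K n \<le> ereal (c + log 2 (real (separation_number T n \<eta>)))"
  shows "limsup (\<lambda>n. K n / ereal (f n)) \<le> entropy_at f T \<eta>"
proof -
  let ?s = "\<lambda>n. log 2 (real (separation_number T n \<eta>))"
  have "eventually (\<lambda>n. f n > 0) sequentially"
    using f by (simp add: filterlim_at_top_dense)
  then have "\<forall>\<^sub>F n in sequentially. K n / ereal (f n) \<le> ereal (c / f n) + ereal (?s n / f n)"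
  proof eventually_elim
    case (elim n)
    then have "K n / ereal (f n) \<le> ereal (c + ?s n) / ereal (f n)"
      by (intro ereal_divide_right_mono le) simp
    also have "\<dots> = ereal (c / f n) + ereal (?s n / f n)" using elim by (simp add: add_divide_distrib)
    finally show ?case .
  qed
  then have "limsup (\<lambda>n. K n / ereal (f n)) \<le> limsup (\<lambda>n. ereal (c / f n) + ereal (?s n / f n))"
    by (rule Limsup_mono)
  also have "\<dots> = 0 + entropy_at f T \<eta>"
    unfolding entropy_at_def
  proof (rule ereal_limsup_lim_add)
    have "(\<lambda>n. c / f n) \<longlonglongrightarrow> 0"
      by (rule tendsto_divide_0[OF tendsto_const filterlim_at_top_imp_at_infinity[OF f]])
    then show "(\<lambda>n. ereal (c / f n)) \<longlonglongrightarrow> 0" by (simp add: zero_ereal_def)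
  qed simp
  finally show ?thesis by simp
qed

section \<open>Certified symbolic words of pseudo-orbits\<close>

text \<open>
  The requirement on \<open>e k\<close> ensures that \<open>T\<close> maps the ball of radius \<open>(1 / 2) ^ e k\<close> into one of half the
  next radius, and the other half is available for the jump to the next point.  All hypotheses are
  local, which makes them checkable one step at a time.
\<close>

lemma pseudo_orbit_shadow:
  fixes T :: "'a::metric_space \<Rightarrow> 'a"
  assumes modulus: "\<And>m x y. dist x y < (1 / 2) ^ g m \<Longrightarrow> dist (T x) (T y) < (1 / 2) ^ m"
    and step: "\<And>k. k < n \<Longrightarrow> dist (T (q k)) (q (Suc k)) < (1 / 2) ^ Suc (e (Suc k))"
    and precision: "\<And>k. k < n \<Longrightarrow> g (Suc (e (Suc k))) \<le> e k"
  shows "k \<le> n \<Longrightarrow> dist ((T ^^ k) (q 0)) (q k) < (1 / 2) ^ e k"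
proof (induction k)
  case (Suc k)
  have "dist ((T ^^ k) (q 0)) (q k) < (1 / 2) ^ g (Suc (e (Suc k)))"
  proof -
    have "dist ((T ^^ k) (q 0)) (q k) < (1 / 2) ^ e k" using Suc by simp
    also have "\<dots> \<le> (1 / 2) ^ g (Suc (e (Suc k)))"
      using precision[of k] Suc.prems by (intro power_decreasing) simp_all
    finally show ?thesis .
  qed
  then have "dist (T ((T ^^ k) (q 0))) (T (q k)) < (1 / 2) ^ Suc (e (Suc k))"
    by (rule modulus)
  with step[of k] Suc.prems show ?case
    using dist_triangle[of "(T ^^ Suc k) (q 0)" "q (Suc k)" "T (q k)"] by simp
qed simp

text \<open>
  The precisions are found backwards from the last one.  After that each point of the orbit can be
  approximated independently of the others.
\<close>

lemma exists_pseudo_orbit: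
  fixes T :: "'a::metric_space \<Rightarrow> 'a"
  assumes modulus: "\<And>m x y. dist x y < (1 / 2) ^ g m \<Longrightarrow> dist (T x) (T y) < (1 / 2) ^ m"
    and dense: "\<And>x r. 0 < r \<Longrightarrow> \<exists>u. dist x (I u) < r"
  shows "\<exists>s e. (\<forall>k\<le>n. dist ((T ^^ k) x) (I (s k)) < (1 / 2) ^ (E + 3) \<and> E \<le> e k) \<and>
    (\<forall>k<n. dist (T (I (s k))) (I (s (Suc k))) \<le> (1 / 2) ^ (Suc (e (Suc k)) + 2) \<and>
      g (Suc (e (Suc k))) \<le> e k)"
proof -
  define F where "F m = max E (g (Suc m))" for m
  define e where "e k = (F ^^ (n - k)) E" for k
  have e_step: "e k = F (e (Suc k))" if "k < n" for k
    using that by (simp add: e_def Suc_diff_Suc[symmetric])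
  have e_ge: "E \<le> e k" for k
  proof -
    have "E \<le> (F ^^ i) E" for i by (cases i) (auto simp: F_def)
    then show ?thesis by (simp add: e_def)
  qed
  \<comment> \<open>The last bound controls the image under \<open>T\<close> of the approximation, the second one the target of a
    step; with exponents \<open>+ 4\<close> both errors together stay below the value that the decidable test
    of proximity accepts\<close>
  define r where "r k = Min {(1 / 2 :: real) ^ (E + 3), (1 / 2) ^ (e k + 4),
    (1 / 2) ^ g (e (Suc k) + 4)}" for k
  have r: "r k > 0" "r k \<le> (1 / 2) ^ (E + 3)" "r k \<le> (1 / 2) ^ (e k + 4)"
    "r k \<le> (1 / 2) ^ g (e (Suc k) + 4)" for k
    by (simp_all add: r_def)
  have "\<forall>k. \<exists>u. dist ((T ^^ k) x) (I u) < r k" using dense r(1) by blast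
  then obtain s where s: "\<And>k. dist ((T ^^ k) x) (I (s k)) < r k" by metis
  show ?thesis
  proof (intro exI[of _ s] exI[of _ e] conjI allI impI)
    show "dist ((T ^^ k) x) (I (s k)) < (1 / 2) ^ (E + 3)" for k
      using s[of k] r(2)[of k] by linarith
    show "g (Suc (e (Suc k))) \<le> e k" if "k < n" for k
      using e_step[OF that] by (simp add: F_def)
    show "E \<le> e k" for k by (rule e_ge)
    show "dist (T (I (s k))) (I (s (Suc k))) \<le> (1 / 2) ^ (Suc (e (Suc k)) + 2)" for k
    proof -
      have "dist ((T ^^ k) x) (I (s k)) < (1 / 2) ^ g (e (Suc k) + 4)"
        using s[of k] r(4)[of k] by linarith
      then have "dist (T ((T ^^ k) x)) (T (I (s k))) < (1 / 2) ^ (e (Suc k) + 4)"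
        by (rule modulus)
      moreover have "dist (T ((T ^^ k) x)) (I (s (Suc k))) < (1 / 2) ^ (e (Suc k) + 4)"
        using s[of "Suc k"] r(3)[of "Suc k"] by simp
      ultimately have "dist (T (I (s k))) (I (s (Suc k))) < 2 * (1 / 2) ^ (e (Suc k) + 4)"
        using dist_triangle3[of "T (I (s k))" "I (s (Suc k))" "T ((T ^^ k) x)"] by linarith
      also have "\<dots> = (1 / 2) ^ (Suc (e (Suc k)) + 2)"
      proof -
        have "e (Suc k) + 4 = Suc (Suc (e (Suc k)) + 2)" by simp
        then show ?thesis by (simp only: power_Suc)
      qed
      finally show ?thesis by simp
    qed
  qed
qed

text \<open>
  The scale is tied to a Lebesgue number of the cover: the letter of a net point is correct for all
  points within distance \<open>6 * (1 / 2) ^ E\<close>.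
\<close>

lemma ideal_net:
  fixes I :: "nat \<Rightarrow> 'a::metric_space"
  assumes "compact (UNIV :: 'a set)" "open_cover \<beta>"
    and dense: "\<And>x r. 0 < r \<Longrightarrow> \<exists>u. dist x (I u) < r"
  obtains E Z letter where "finite Z" "\<And>x. \<exists>z\<in>Z. dist x (I z) < (1 / 2) ^ (E + 3)"
    and "\<And>z. letter z < length \<beta>" "\<And>z. ball (I z) (6 * (1 / 2) ^ E) \<subseteq> \<beta> ! letter z"
proof -
  have "\<Union>(set \<beta>) = UNIV" "\<forall>B\<in>set \<beta>. open B" using assms(2) by (auto simp: open_cover_def)
  then obtain r where r: "r > 0" "\<And>x. \<exists>B\<in>set \<beta>. ball x r \<subseteq> B"
    using Heine_Borel_lemma[OF assms(1), of "set \<beta>"] by (metis UNIV_I subset_UNIV)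
  obtain E where E: "(1 / 2 :: real) ^ E < r / 6"
    using real_arch_pow_inv[of "r / 6" "1 / 2"] r(1) by auto
  have "\<forall>z. \<exists>i. i < length \<beta> \<and> ball (I z) (6 * (1 / 2) ^ E) \<subseteq> \<beta> ! i"
  proof
    fix z
    obtain B where "B \<in> set \<beta>" "ball (I z) r \<subseteq> B" using r(2) by blast
    moreover have "ball (I z) (6 * (1 / 2) ^ E) \<subseteq> ball (I z) r" using E by (intro subset_ball) simp
    ultimately show "\<exists>i. i < length \<beta> \<and> ball (I z) (6 * (1 / 2) ^ E) \<subseteq> \<beta> ! i"
      by (metis in_set_conv_nth order_trans)
  qed
  then obtain letter where letter: "\<And>z. letter z < length \<beta> \<and> ball (I z) (6 * (1 / 2) ^ E) \<subseteq> \<beta> ! letter z"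
    by metis
  have "x \<in> (\<Union>u. ball (I u) ((1 / 2) ^ (E + 3)))" for x
    using dense[of "(1 / 2) ^ (E + 3)" x] by (auto simp: dist_commute)
  then obtain Z where "finite Z" "UNIV \<subseteq> (\<Union>u\<in>Z. ball (I u) ((1 / 2) ^ (E + 3)))"
    using compactE_image[OF assms(1), of UNIV "\<lambda>u. ball (I u) ((1 / 2) ^ (E + 3))"]
    by (metis open_ball subsetI)
  then have net: "\<exists>z\<in>Z. dist x (I z) < (1 / 2) ^ (E + 3)" for x
  proof -
    have "x \<in> (\<Union>u\<in>Z. ball (I u) ((1 / 2) ^ (E + 3)))"
      using \<open>UNIV \<subseteq> _\<close> by (rule subsetD) simp
    then show ?thesis by (auto simp: dist_commute)
  qed
  show ?thesis
  proof (rule that[of Z E letter])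
    show "finite Z" by fact
    show "\<exists>z\<in>Z. dist x (I z) < (1 / 2) ^ (E + 3)" for x by (rule net)
    show "letter z < length \<beta>" "ball (I z) (6 * (1 / 2) ^ E) \<subseteq> \<beta> ! letter z" for z
      using letter by blast+
  qed
qed

text \<open>
  A certificate consists of a word, a list of net points, a pseudo-orbit of ideal points and the list of
  its precisions; the decidable tests \<open>N\<close> and \<open>N'\<close> of proximity to a point and to an image point suffice to
  check it.  \<open>P t\<close> is the first point of the pseudo-orbit.  With \<open>\<eta> = (1 / 2) ^ E\<close>, the orbit of \<open>P t\<close>
  is within \<open>2 * \<eta>\<close> of the net points.  Net points at distance more than \<open>5 * \<eta>\<close> hence belong to points
  that are more than \<open>\<eta>\<close> apart, which justifies the choice of \<open>S\<close>.  An arbitrary orbit has a certificate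
  with net points within \<open>\<eta>\<close>; those of any certificate not separated from it are then within \<open>6 * \<eta>\<close> of
  the orbit, so that their letters describe the orbit as well.
\<close>

lemma certified_words:
  fixes I :: "nat \<Rightarrow> 'a::metric_space" and T :: "'a \<Rightarrow> 'a"
  assumes "compact (UNIV :: 'a set)" and "open_cover \<beta>"
    and dense: "\<And>x r. 0 < r \<Longrightarrow> \<exists>u. dist x (I u) < r"
    and modulus: "\<And>m x y. dist x y < (1 / 2) ^ g m \<Longrightarrow> dist (T x) (T y) < (1 / 2) ^ m"
    and g: "recfn 1 (\<lambda>xs. g (xs ! 0))"
    and N: "decid 3 (\<lambda>xs. N (xs ! 0) (xs ! 1) (xs ! 2))"
    and N_sound: "\<And>u v e. N u v e \<Longrightarrow> dist (I u) (I v) < (1 / 2) ^ e"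
    and N_complete: "\<And>u v e. dist (I u) (I v) \<le> (1 / 2) ^ (e + 2) \<Longrightarrow> N u v e"
    and N': "decid 3 (\<lambda>xs. N' (xs ! 0) (xs ! 1) (xs ! 2))"
    and N'_sound: "\<And>u v e. N' u v e \<Longrightarrow> dist (T (I u)) (I v) < (1 / 2) ^ e"
    and N'_complete: "\<And>u v e. dist (T (I u)) (I v) \<le> (1 / 2) ^ (e + 2) \<Longrightarrow> N' u v e"
  obtains \<eta> V S P where "\<eta> > 0"
    and "decid 2 (\<lambda>xs. V (xs ! 0) (xs ! 1))"
    and "decid 3 (\<lambda>xs. S (xs ! 0) (xs ! 1) (xs ! 2))"
    and "\<And>n t. V n t \<Longrightarrow> length (list_decode (pfst t)) = n \<and> list_decode (pfst t) \<in> lists {..<length \<beta>}"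
    and "\<And>n t t'. V n t \<Longrightarrow> V n t' \<Longrightarrow> S n t t' \<Longrightarrow>
      \<exists>k<n. dist ((T ^^ k) (P t)) ((T ^^ k) (P t' :: 'a)) > \<eta>"
    and "\<And>x n. \<exists>t. V n t \<and> (\<forall>t'. V n t' \<and> (t' = t \<or> \<not> S n t t') \<longrightarrow>
      (\<forall>k<n. (T ^^ k) x \<in> \<beta> ! (list_decode (pfst t') ! k)))"
proof -
  obtain E Z letter where "finite Z" and net: "\<And>x. \<exists>z\<in>Z. dist x (I z) < (1 / 2) ^ (E + 3)"
    and letter: "\<And>z. letter z < length \<beta>" "\<And>z. ball (I z) (6 * (1 / 2) ^ E) \<subseteq> \<beta> ! letter z"
    using ideal_net[OF assms(1,2) dense] by metis
  define \<eta> :: real where "\<eta> = (1 / 2) ^ E"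
  have "\<eta> > 0" by (simp add: \<eta>_def)
  define A where "A = (\<lambda>z. (z, letter z)) ` Z"
  define R where "R = {(z, z') \<in> Z \<times> Z. dist (I z) (I z') > 5 * \<eta>}"
  have fin: "finite A" "finite R"
    using \<open>finite Z\<close> by (auto simp: A_def R_def intro: finite_subset[of _ "Z \<times> Z"])
  \<comment> \<open>the components of a certificate; the first one, \<open>pfst t\<close>, is the code of the word\<close>
  define net_pts where "net_pts t = lnth (pfst (psnd t))" for t
  define pts where "pts t = lnth (pfst (psnd (psnd t)))" for t
  define prec where "prec t = lnth (psnd (psnd (psnd t)))" for t
  note defs = net_pts_def pts_def prec_def
  define V where "V n t \<longleftrightarrow> ldrop n (pfst t) = 0 \<and> (\<forall>k<n. \<not> ldrop k (pfst t) = 0 \<and>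
    (net_pts t k, lnth (pfst t) k) \<in> A \<and> N (pts t k) (net_pts t k) E \<and> E \<le> prec t k \<and>
    N' (pts t k) (pts t (Suc k)) (Suc (prec t (Suc k))) \<and> g (Suc (prec t (Suc k))) \<le> prec t k)" for n t
  define S where "S n t t' \<longleftrightarrow> (\<exists>k<n. (net_pts t k, net_pts t' k) \<in> R)" for n t t'
  have word: "length (list_decode (pfst t)) = n \<and>
      (\<forall>k<n. lnth (pfst t) k = list_decode (pfst t) ! k \<and> net_pts t k \<in> Z \<and>
        list_decode (pfst t) ! k = letter (net_pts t k))" if "V n t" for n t
  proof -
    obtain w where w: "pfst t = list_encode w" by (metis list_decode_inverse)
    have "length w \<le> n" "\<And>k. k < n \<Longrightarrow> k < length w"
      using that by (auto simp: V_def w ldrop_eq_0)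
    then have "length w = n" by (meson antisym_conv2 less_irrefl)
    then show ?thesis using that by (auto simp: V_def w lnth_list_encode A_def)
  qed
  have shadow: "dist ((T ^^ k) (I (pts t 0))) (I (net_pts t k)) < 2 * \<eta>" if "V n t" "k < n" for n t k
  proof -
    have "dist ((T ^^ k) (I (pts t 0))) (I (pts t k)) < (1 / 2) ^ prec t k"
      by (rule pseudo_orbit_shadow[where n=n and q="\<lambda>k. I (pts t k)" and g=g, OF modulus])
        (use that N'_sound in \<open>auto simp: V_def simp del: power_Suc\<close>)
    also have "\<dots> \<le> \<eta>" using that by (auto simp: \<eta>_def V_def intro: power_decreasing)
    finally have "dist ((T ^^ k) (I (pts t 0))) (I (pts t k)) < \<eta>" .
    moreover have "dist (I (pts t k)) (I (net_pts t k)) < \<eta>"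
      using that N_sound by (auto simp: V_def \<eta>_def)
    ultimately show ?thesis
      using dist_triangle[of "(T ^^ k) (I (pts t 0))" "I (net_pts t k)" "I (pts t k)"] by linarith
  qed
  show ?thesis
  proof (rule that[of \<eta> V S "\<lambda>t. I (pts t 0)"])
    show "decid 2 (\<lambda>xs. V (xs ! 0) (xs ! 1))"
      unfolding V_def defs
      by (intro recintros fin decid_compose3[where P=N, OF N] decid_compose3[where P=N', OF N']
          recfn_compose1[where h=g, OF g]) simp_all
    show "decid 3 (\<lambda>xs. S (xs ! 0) (xs ! 1) (xs ! 2))"
      unfolding S_def defs by (intro recintros fin) simp_all
    show "length (list_decode (pfst t)) = n \<and> list_decode (pfst t) \<in> lists {..<length \<beta>}"
      if "V n t" for n t
      using word[OF that] letter(1) by (auto simp: in_set_conv_nth in_lists_conv_set)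
    show "\<exists>k<n. dist ((T ^^ k) (I (pts t 0))) ((T ^^ k) (I (pts t' 0))) > \<eta>"
      if V: "V n t" "V n t'" and "S n t t'" for n t t'
    proof -
      obtain k where k: "k < n" "dist (I (net_pts t k)) (I (net_pts t' k)) > 5 * \<eta>"
        using \<open>S n t t'\<close> by (auto simp: S_def R_def)
      show ?thesis
        using k shadow[OF V(1) k(1)] shadow[OF V(2) k(1)]
          dist_triangle[of "I (net_pts t k)" "I (net_pts t' k)" "(T ^^ k) (I (pts t 0))"]
          dist_triangle[of "(T ^^ k) (I (pts t 0))" "I (net_pts t' k)" "(T ^^ k) (I (pts t' 0))"]
        by (intro exI[of _ k]) (simp add: dist_commute)
    qed
    show "\<exists>t. V n t \<and> (\<forall>t'. V n t' \<and> (t' = t \<or> \<not> S n t t') \<longrightarrow>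
        (\<forall>k<n. (T ^^ k) x \<in> \<beta> ! (list_decode (pfst t') ! k)))" for x n
    proof -
      obtain s e where s: "\<And>k. k \<le> n \<Longrightarrow> dist ((T ^^ k) x) (I (s k)) < (1 / 2) ^ (E + 3)"
        and step: "\<And>k. k < n \<Longrightarrow> dist (T (I (s k))) (I (s (Suc k))) \<le> (1 / 2) ^ (Suc (e (Suc k)) + 2)"
        and e: "\<And>k. k < n \<Longrightarrow> g (Suc (e (Suc k))) \<le> e k" "\<And>k. k \<le> n \<Longrightarrow> E \<le> e k"
        using exists_pseudo_orbit[where T=T and g=g and I=I and n=n and x=x and E=E, OF modulus dense] by blast
      have "\<forall>k. \<exists>z. z \<in> Z \<and> dist ((T ^^ k) x) (I z) < (1 / 2) ^ (E + 3)"
        using net by blast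
      then obtain z where "\<forall>k. z k \<in> Z \<and> dist ((T ^^ k) x) (I (z k)) < (1 / 2) ^ (E + 3)"
        by (rule choice[THEN exE])
      then have z: "\<And>k. z k \<in> Z" "\<And>k. dist ((T ^^ k) x) (I (z k)) < (1 / 2) ^ (E + 3)"
        by blast+
      \<comment> \<open>the pseudo-orbit and the precisions have one entry more than the word, since the condition at
        the last letter refers to the next point\<close>
      define w where "w = map (\<lambda>k. letter (z k)) [0..<n]"
      define t where "t = prod_encode (list_encode w, prod_encode (list_encode (map z [0..<n]),
        prod_encode (list_encode (map s [0..<Suc n]), list_encode (map e [0..<Suc n]))))"
      have t_net: "net_pts t k = z k" if "k < n" for k
        using that unfolding t_def defs by (simp add: lnth_list_encode)
      have t: "pts t k = s k" "prec t k = e k" if "k < Suc n" for k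
        using that unfolding t_def defs by (simp_all add: lnth_list_encode del: upt_Suc)
      have "N (s k) (z k) E" if "k < n" for k
      proof (rule N_complete)
        have "dist (I (s k)) (I (z k)) \<le> 2 * (1 / 2) ^ (E + 3)"
          using s[of k] z(2)[of k] that dist_triangle3[of "I (s k)" "I (z k)" "(T ^^ k) x"] by simp
        moreover have "(1 / 2 :: real) ^ (E + 3) = 1 / 2 * (1 / 2) ^ (E + 2)"
        proof -
          have "E + 3 = Suc (E + 2)" by simp
          then show ?thesis by (simp only: power_Suc)
        qed
        ultimately show "dist (I (s k)) (I (z k)) \<le> (1 / 2) ^ (E + 2)" by linarith
      qed
      moreover have "pfst t = list_encode w" by (simp add: t_def)
      ultimately have V: "V n t"
        using z(1) step e N'_complete
        by (auto simp: V_def t t_net ldrop_eq_0 lnth_list_encode w_def A_def simp del: power_Suc)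
      have "(T ^^ k) x \<in> \<beta> ! (list_decode (pfst t') ! k)"
        if V': "V n t'" and S: "t' = t \<or> \<not> S n t t'" and k: "k < n" for t' k
      proof -
        have "dist (I (z k)) (I (net_pts t' k)) \<le> 5 * \<eta>"
        proof (cases "t' = t")
          case True
          then show ?thesis using t_net[OF k] \<open>\<eta> > 0\<close> by simp
        next
          case False
          then have "(net_pts t k, net_pts t' k) \<notin> R" using S k by (auto simp: S_def)
          then show ?thesis using z(1) word[OF V'] k t_net[OF k] by (auto simp: R_def)
        qed
        moreover have "dist ((T ^^ k) x) (I (z k)) < \<eta>"
        proof -
          have "(1 / 2 :: real) ^ (E + 3) \<le> \<eta>"
            unfolding \<eta>_def by (rule power_decreasing) simp_all
          with z(2)[of k] show ?thesis by linarith
        qed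
        ultimately have "dist ((T ^^ k) x) (I (net_pts t' k)) < 6 * \<eta>"
          using dist_triangle[of "(T ^^ k) x" "I (net_pts t' k)" "I (z k)"] by linarith
        then have "(T ^^ k) x \<in> ball (I (net_pts t' k)) (6 * (1 / 2) ^ E)"
          by (simp add: dist_commute \<eta>_def)
        then have "(T ^^ k) x \<in> \<beta> ! letter (net_pts t' k)" using letter(2) by blast
        then show ?thesis using word[OF V'] k by simp
      qed
      with V show ?thesis by blast
    qed
  qed (rule \<open>\<eta> > 0\<close>)
qed

section \<open>Orbit complexity is bounded by entropy\<close>

text \<open>
  The word of the greedily selected certificate that is not separated from a certificate for \<open>x\<close> is the
  beginning of a symbolic orbit of \<open>x\<close>.  Its rank among the selected certificates is the index by which
  it is coded.
\<close>

lemma orbit_complexity_n_le: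
  fixes T :: "'a::metric_space \<Rightarrow> 'a"
  assumes pairing: "recursive_pairing pair"
    and universal: "universal_machine a pair U"
    and encoding: "recursive_word_encoding a enc"
    and compact: "compact (UNIV :: 'a set)" and struct: "computable_structure \<I>"
    and T: "uniformly_constructive \<I> \<I> T" and \<beta>: "open_cover \<beta>"
  shows "\<exists>c \<eta>. \<eta> > 0 \<and> (\<forall>n. ereal_of_enat (orbit_complexity_n pair U enc x T \<beta> n) \<le>
    ereal (real c + log 2 (real (separation_number T n \<eta>))))"
proof -
  let ?N = "length \<beta>"
  obtain I0 where I0: "computable_interpretation I0" "\<I> = interpretation_equiv `` {I0}"
    using struct unfolding computable_structure_def by (auto elim!: quotientE)
  then have "I0 \<in> \<I>"
    unfolding computable_interpretation_def interpretation_equiv_def by simp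
  have cont: "continuous_on UNIV T"
    and approx': "recursively_approximable (\<lambda>s1 s2. dist (T (I0 s1)) (I0 s2))"
    using T \<open>I0 \<in> \<I>\<close> unfolding uniformly_constructive_def constructive_morphism_def by blast+
  obtain g where "total_recursive g"
    and modulus: "\<And>m x y. dist x y < (1 / 2) ^ g m \<Longrightarrow> dist (T x) (T y) < (1 / 2) ^ m"
    using T unfolding uniformly_constructive_def by blast
  from \<open>total_recursive g\<close> obtain rg where rg: "\<And>n. computes rg [n] (g n)"
    unfolding total_recursive_def by blast
  have g: "recfn 1 (\<lambda>xs. g (xs ! 0))"
    unfolding recfn_def using rg by (auto simp: length_Suc_conv intro!: exI[of _ rg])
  define I where "I u = I0 (string_of u)" for u
  have dense: "\<exists>u. dist x (I u) < r" if r: "0 < r" for x r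
  proof -
    have "x \<in> closure (range I0)" using I0(1) by (simp add: computable_interpretation_def)
    then obtain s where "dist (I0 s) x < r" using r unfolding closure_approachable by blast
    then show ?thesis by (intro exI[of _ "string_code s"]) (simp add: I_def dist_commute)
  qed
  have approx: "recursively_approximable (\<lambda>s1 s2. dist (I0 s1) (I0 s2))"
    using I0(1) by (simp add: computable_interpretation_def)
  from decid_approximable[OF approx, folded I_def] obtain N where
    "decid 3 (\<lambda>xs. N (xs ! 0) (xs ! 1) (xs ! 2)) \<and>
      (\<forall>u v e. N u v e \<longrightarrow> dist (I u) (I v) < (1 / 2) ^ e) \<and>
      (\<forall>u v e. dist (I u) (I v) \<le> (1 / 2) ^ (e + 2) \<longrightarrow> N u v e)" ..
  then have N: "decid 3 (\<lambda>xs. N (xs ! 0) (xs ! 1) (xs ! 2))"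
      "\<And>u v e. N u v e \<Longrightarrow> dist (I u) (I v) < (1 / 2) ^ e"
      "\<And>u v e. dist (I u) (I v) \<le> (1 / 2) ^ (e + 2) \<Longrightarrow> N u v e"
    by blast+
  from decid_approximable[OF approx', folded I_def] obtain N' where
    "decid 3 (\<lambda>xs. N' (xs ! 0) (xs ! 1) (xs ! 2)) \<and>
      (\<forall>u v e. N' u v e \<longrightarrow> dist (T (I u)) (I v) < (1 / 2) ^ e) \<and>
      (\<forall>u v e. dist (T (I u)) (I v) \<le> (1 / 2) ^ (e + 2) \<longrightarrow> N' u v e)" ..
  then have N': "decid 3 (\<lambda>xs. N' (xs ! 0) (xs ! 1) (xs ! 2))"
      "\<And>u v e. N' u v e \<Longrightarrow> dist (T (I u)) (I v) < (1 / 2) ^ e"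
      "\<And>u v e. dist (T (I u)) (I v) \<le> (1 / 2) ^ (e + 2) \<Longrightarrow> N' u v e"
    by blast+
  show ?thesis
  proof (rule certified_words[where T=T and I=I and g=g and N=N and N'=N',
        OF compact \<beta> dense modulus g N N'])
    fix \<eta> V S and P :: "nat \<Rightarrow> 'a"
    assume "\<eta> > 0" and V: "decid 2 (\<lambda>xs. V (xs ! 0) (xs ! 1))"
      and S: "decid 3 (\<lambda>xs. S (xs ! 0) (xs ! 1) (xs ! 2))"
      and word: "\<And>n t. V n t \<Longrightarrow>
        length (list_decode (pfst t)) = n \<and> list_decode (pfst t) \<in> lists {..<?N}"
      and sep: "\<And>n t t'. V n t \<Longrightarrow> V n t' \<Longrightarrow> S n t t' \<Longrightarrow>
        \<exists>k<n. dist ((T ^^ k) (P t)) ((T ^^ k) (P t')) > \<eta>"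
      and certificate: "\<And>x n. \<exists>t. V n t \<and> (\<forall>t'. V n t' \<and> (t' = t \<or> \<not> S n t t') \<longrightarrow>
        (\<forall>k<n. (T ^^ k) x \<in> \<beta> ! (list_decode (pfst t') ! k)))"
    note encN = encoding[unfolded recursive_word_encoding_def, THEN spec, of ?N]
    have enc_in: "enc ?N ` lists {..<?N} \<subseteq> lists {..<a}"
      using encN by (elim conjE)
    obtain re where "\<forall>s\<in>lists {..<?N}. computes re [list_encode s] (list_encode (enc ?N s))"
      using encN by (elim conjE exE)
    then have re: "computes re [list_encode s] (list_encode (enc ?N s))"
      if "s \<in> lists {..<?N}" for s
      using that by (rule bspec)
    have "recfn 1 (\<lambda>xs. pfst (xs ! 0))" by (intro recintros) simp
    then obtain rp where "\<forall>xs. length xs = 1 \<longrightarrow> computes rp xs (pfst (xs ! 0))"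
      unfolding recfn_def ..
    then have rp: "computes rp [t] (pfst t)" for t by (auto dest!: spec[of _ "[t]"])
    define h where "h t = enc ?N (list_decode (pfst t))" for t
    define Q where "Q n v t \<longleftrightarrow> (\<exists>l. greedy (V n) (S n) (Suc t) = t # l \<and> length l = v)" for n v t
    have Q_valid: "V n t" if "Q n v t" for n v t
    proof -
      obtain l where l: "greedy (V n) (S n) (Suc t) = t # l"
        using \<open>Q n v t\<close> unfolding Q_def by blast
      have "t \<in> set (greedy (V n) (S n) (Suc t))" unfolding l by simp
      then show ?thesis by (rule greedy_valid)
    qed
    have "\<exists>c. \<forall>n v t. Q n v t \<longrightarrow>
        AIC pair U (h t) (binary_expansion n) \<le> enat (c + length (string_of v))"
    proof (rule indexed_coding[OF pairing universal, where Q=Q and h=h and r="Comp re [rp]"])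
      show "decid 3 (\<lambda>xs. Q (xs ! 0) (xs ! 1) (xs ! 2))"
        unfolding Q_def using V S by (rule decid_greedy_rank)
      show "h t \<in> lists {..<a} \<and> computes (Comp re [rp]) [t] (list_encode (h t))"
        if "Q n v t" for n v t
      proof
        have w: "list_decode (pfst t) \<in> lists {..<?N}" using word Q_valid[OF that] by blast
        then show "h t \<in> lists {..<a}" using enc_in by (auto simp: h_def)
        show "computes (Comp re [rp]) [t] (list_encode (h t))"
          using rp[of t] re[OF w] by (auto simp: h_def intro!: computes.comp)
      qed
      show "t = t'" if "Q n v t" "Q n v t'" for n v t t'
        using that greedy_rank_unique unfolding Q_def by metis
    qed
    then obtain c where "\<forall>n v t. Q n v t \<longrightarrow>
        AIC pair U (h t) (binary_expansion n) \<le> enat (c + length (string_of v))" ..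
    then have c: "AIC pair U (h t) (binary_expansion n) \<le> enat (c + length (string_of v))"
      if "Q n v t" for n v t
      using that by blast
    have "ereal_of_enat (orbit_complexity_n pair U enc x T \<beta> n) \<le>
      ereal (real c + log 2 (real (separation_number T n \<eta>)))" for n
    proof -
      obtain t where t: "V n t" "\<And>t' k. V n t' \<Longrightarrow> t' = t \<or> \<not> S n t t' \<Longrightarrow> k < n \<Longrightarrow>
          (T ^^ k) x \<in> \<beta> ! (list_decode (pfst t') ! k)"
        using certificate[of n x] by blast
      obtain t' where t': "t' \<in> set (greedy (V n) (S n) (Suc t))" "t' = t \<or> \<not> S n t t'"
        using greedy_maximal[of "V n" t "S n", OF t(1)] by blast
      have V': "V n t'" using greedy_valid[OF t'(1)] .
      obtain l where l: "greedy (V n) (S n) (Suc t') = t' # l"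
          "length l < length (greedy (V n) (S n) (Suc t))"
        using greedy_stage[OF t'(1)] by blast
      let ?v = "length l"
      have "?v + 1 \<le> separation_number T n \<eta>"
        using l(2) length_greedy_le_separation_number[where V="V n" and S="S n" and P=P and t="Suc t" and n=n,
          OF compact cont \<open>\<eta> > 0\<close> sep] by simp
      then have "log 2 (real (?v + 1)) \<le> log 2 (real (separation_number T n \<eta>))"
        by (subst log_le_cancel_iff) (simp_all del: of_nat_add)
      with length_string_of_le[of ?v]
      have v: "real (length (string_of ?v)) \<le> log 2 (real (separation_number T n \<eta>))" by linarith
      let ?w = "list_decode (pfst t')"
      have "\<exists>i. i < ?N \<and> y \<in> \<beta> ! i" for y
        using \<beta> unfolding open_cover_def by (metis UNIV_I UnionE in_set_conv_nth)
      then obtain idx where idx: "\<And>y. idx y < ?N \<and> y \<in> \<beta> ! idx y" by metis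
      \<comment> \<open>beyond \<open>n\<close> the letters of the symbolic orbit do not matter and are chosen arbitrarily\<close>
      define \<omega> where "\<omega> k = (if k < n then ?w ! k else idx ((T ^^ k) x))" for k
      have len: "length ?w = n" and letters: "?w \<in> lists {..<?N}" using word[OF V'] by auto
      have "\<omega> \<in> symbolic_orbits T \<beta> x"
        using t(2)[OF V' t'(2)] idx letters len
        by (auto simp: symbolic_orbits_def \<omega>_def in_lists_conv_set)
      moreover have "map \<omega> [0..<n] = ?w"
        using len by (auto simp: \<omega>_def intro!: nth_equalityI)
      ultimately have "orbit_complexity_n pair U enc x T \<beta> n \<le> AIC pair U (h t') (binary_expansion n)"
        unfolding orbit_complexity_n_def h_def by (metis (mono_tags, lifting) INF_lower)
      also have "\<dots> \<le> enat (c + length (string_of ?v))"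
      proof (rule c)
        show "Q n ?v t'" unfolding Q_def using l(1) by blast
      qed
      finally have "ereal_of_enat (orbit_complexity_n pair U enc x T \<beta> n) \<le>
          ereal_of_enat (enat (c + length (string_of ?v)))"
        by (simp only: ereal_of_enat_le_iff)
      also have "\<dots> \<le> ereal (real c + log 2 (real (separation_number T n \<eta>)))"
        using v by simp
      finally show ?thesis .
    qed
    with \<open>\<eta> > 0\<close> show ?thesis by blast
  qed
qed

theorem theorem35:
  fixes \<I> :: "(bool list \<Rightarrow> 'a::metric_space) set"
    and T :: "'a \<Rightarrow> 'a"
    and x :: 'a
    and f :: "nat \<Rightarrow> real"
    and a :: nat
    and pair :: "bool list \<Rightarrow> bool list \<Rightarrow> bool list"
    and U :: "bool list \<Rightarrow> nat list option"
    and enc :: "nat \<Rightarrow> nat list \<Rightarrow> nat list"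
  assumes "recursive_pairing pair"
    and "universal_machine a pair U"
    and "recursive_word_encoding a enc"
    and "compact (UNIV :: 'a set)"
    and "computable_structure \<I>"
    and "uniformly_constructive \<I> \<I> T"
    and "mono f"
    and "filterlim f at_top sequentially"
  shows "orbit_complexity pair U enc f x T \<le> topological_entropy f T"
  unfolding orbit_complexity_def
proof (rule SUP_least)
  fix \<beta> :: "'a set list" assume "\<beta> \<in> {\<beta>. open_cover \<beta>}"
  then obtain c \<eta> where "\<eta> > 0"
    and le: "\<And>n. ereal_of_enat (orbit_complexity_n pair U enc x T \<beta> n) \<le>
      ereal (real c + log 2 (real (separation_number T n \<eta>)))"
    using orbit_complexity_n_le[OF assms(1-6), of \<beta> x] by auto
  have "continuous_on UNIV T"
    using assms(6) unfolding uniformly_constructive_def constructive_morphism_def by blast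
  have "orbit_complexity_cover pair U enc f x T \<beta> \<le> entropy_at f T \<eta>"
    unfolding orbit_complexity_cover_def by (rule limsup_bounded_by_entropy[OF assms(8) le])
  also have "\<dots> \<le> topological_entropy f T"
    by (rule entropy_at_le_topological_entropy[OF assms(4) \<open>continuous_on UNIV T\<close> assms(8) \<open>\<eta> > 0\<close>])
  finally show "orbit_complexity_cover pair U enc f x T \<beta> \<le> topological_entropy f T" .
qed

end
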